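(* Let $K$ be a field, $S=K[X_1,\dots,X_n]$ the standard graded polynomial ring, $\mathfrak m=(X_1,\dots,X_n)$, $c\ge1$ an integer, and $N=\binom{n+c-1}{c}$. Then $$\dim_K H_i(\mathfrak m^c)_j=\dim_K H_{N-n-i}(\mathfrak m^c)_{Nc-n-j}\qquad\text{for all } i,j\in\mathbb Z,\ i,j\ge 0.$$
   Context: $K(\mathfrak m^c)$ is the graded Koszul complex over $S$ associated to the $N$ monomials of degree $c$ in $S$: $K_t(\mathfrak m^c)=S\otimes_K\bigwedge^tS_c$, with elements of $\bigwedge^tS_c$ placed in degree $tc$, so that the differential has degree $0$. $H_i(\mathfrak m^c)$ is its $i$-th homology, a $\mathbb Z$-graded $S$-module, and $H_i(\mathfrak m^c)_j$ its degree $j$ component; $H_i(\mathfrak m^c)=0$ for $i<0$. *)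

theory Defs
  imports "HOL-Library.Poly_Mapping" "HOL-Algebra.QuotRing" "Jordan_Normal_Form.VS_Connect"
begin

text \<open>Monomials are exponent vectors, variables are indexed by \<open>{..<n}\<close>.\<close>

type_synonym monomial = "nat \<Rightarrow>\<^sub>0 nat"
type_synonym 'k mpoly = "monomial \<Rightarrow>\<^sub>0 'k"

definition mon_deg :: "monomial \<Rightarrow> nat" where
  "mon_deg m = (\<Sum>x\<in>Poly_Mapping.keys m. Poly_Mapping.lookup m x)"

definition monomials :: "nat \<Rightarrow> monomial set" where
  "monomials n = {m. Poly_Mapping.keys m \<subseteq> {..<n}}"

definition monomials_of_deg :: "nat \<Rightarrow> nat \<Rightarrow> monomial set" where
  "monomials_of_deg n c = {m \<in> monomials n. mon_deg m = c}"

definition poly_ring :: "nat \<Rightarrow> 'k::field mpoly ring" where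
  "poly_ring n = \<lparr>carrier = {p. Poly_Mapping.keys p \<subseteq> monomials n},
     mult = (*), one = 1, zero = 0, add = (+)\<rparr>"

text \<open>The monomials of degree \<open>c\<close> form a basis of \<open>S\<^sub>c\<close>, so \<open>S \<otimes> \<And>\<^sup>t S\<^sub>c\<close> is the free \<open>S\<close>-module
  on the elements \<open>e\<^sub>A = m\<^sub>1 \<and> \<dots> \<and> m\<^sub>t\<close>, where \<open>A = {m\<^sub>1 < \<dots> < m\<^sub>t}\<close> ranges over the \<open>t\<close>-element
  sets of such monomials, listed in the (arbitrarily chosen) linear order which
  \<^theory>\<open>HOL-Library.Poly_Mapping\<close> provides. An element is the family of its coefficients.
  For \<open>t < 0\<close> the module is zero.\<close>

type_synonym 'k koszul = "monomial set \<Rightarrow>\<^sub>0 'k mpoly"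

definition koszul_module :: "nat \<Rightarrow> nat \<Rightarrow> int \<Rightarrow> ('k::field mpoly, 'k koszul) module" where
  "koszul_module n c t =
    \<lparr>carrier = {u. \<forall>A\<in>Poly_Mapping.keys u. A \<subseteq> monomials_of_deg n c \<and> int (card A) = t
                    \<and> Poly_Mapping.lookup u A \<in> carrier (poly_ring n)},
     mult = undefined, one = undefined, zero = 0, add = (+),
     smult = (\<lambda>p. Poly_Mapping.map (\<lambda>q. p * q))\<rparr>"

text \<open>\<open>e\<^sub>A \<mapsto> \<Sum>\<^sub>k (-1)\<^sup>k\<^sup>-\<^sup>1 m\<^sub>k e\<^bsub>A - {m\<^sub>k}\<^esub>\<close>, extended \<open>S\<close>-linearly.\<close>

definition koszul_diff :: "'k::field koszul \<Rightarrow> 'k koszul" where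
  "koszul_diff u = (\<Sum>A\<in>Poly_Mapping.keys u. \<Sum>m\<in>A.
     Poly_Mapping.single (A - {m})
       ((-1) ^ card {m' \<in> A. m' < m} * Poly_Mapping.single m 1 * Poly_Mapping.lookup u A))"

text \<open>\<open>e\<^sub>A\<close> has degree \<open>|A| c\<close>.\<close>

definition koszul_homogeneous :: "nat \<Rightarrow> int \<Rightarrow> 'k::field koszul set" where
  "koszul_homogeneous c j = {u. \<forall>A\<in>Poly_Mapping.keys u.
     \<forall>m\<in>Poly_Mapping.keys (Poly_Mapping.lookup u A). int (mon_deg m) + int (card A * c) = j}"

definition koszul_cycles :: "nat \<Rightarrow> nat \<Rightarrow> int \<Rightarrow> ('k::field mpoly, 'k koszul) module" where
  "koszul_cycles n c i =
     (koszul_module n c i)\<lparr>carrier := {u \<in> carrier (koszul_module n c i). koszul_diff u = 0}\<rparr>"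

definition koszul_boundaries :: "nat \<Rightarrow> nat \<Rightarrow> int \<Rightarrow> 'k::field koszul set" where
  "koszul_boundaries n c i = koszul_diff ` carrier (koszul_module n c (i + 1))"

text \<open>The quotient of a module by a submodule, in the style of \<^const>\<open>FactRing\<close>.\<close>

definition fact_module :: "('a, 'b) module \<Rightarrow> 'b set \<Rightarrow> ('a, 'b set) module" where
  "fact_module M B =
    \<lparr>carrier = a_rcosets\<^bsub>M\<^esub> B, mult = undefined, one = undefined, zero = B, add = set_add M,
     smult = (\<lambda>a X. \<Union>x\<in>X. B +>\<^bsub>M\<^esub> (a \<odot>\<^bsub>M\<^esub> x))\<rparr>"

definition koszul_homology :: "nat \<Rightarrow> nat \<Rightarrow> int \<Rightarrow> ('k::field mpoly, 'k koszul set) module" where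
  "koszul_homology n c i = fact_module (koszul_cycles n c i) (koszul_boundaries n c i)"

text \<open>The degree \<open>j\<close> component of \<open>H\<^sub>i\<close> consists of the classes of homogeneous cycles of degree \<open>j\<close>;
  its scalars are restricted from \<open>S\<close> to the constants \<open>K\<close>.\<close>

definition koszul_homology_component ::
    "nat \<Rightarrow> nat \<Rightarrow> int \<Rightarrow> int \<Rightarrow> ('k::field, 'k koszul set) module" where
  "koszul_homology_component n c i j =
    \<lparr>carrier = (\<lambda>z. koszul_boundaries n c i +>\<^bsub>koszul_cycles n c i\<^esub> z) `
                 (carrier (koszul_cycles n c i) \<inter> koszul_homogeneous c j),
     mult = undefined, one = undefined,
     zero = zero (koszul_homology n c i), add = add (koszul_homology n c i),
     smult = (\<lambda>a. smult (koszul_homology n c i) (Poly_Mapping.single 0 a))\<rparr>"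

end

theory Submission
  imports Defs "HOL-Library.Function_Algebras"
begin

text \<open>
  The statement is a form of local duality, proved here on the level of monomials.

  Let \<open>U\<close> be the set of the \<open>N\<close> monomials of degree \<open>c\<close>. For \<open>k \<le> n\<close> let \<open>M\<^sub>k\<close> be the vector space
  spanned by the Laurent monomials \<open>x\<^sup>a\<close> whose exponents are negative in the first \<open>k\<close> variables and
  nonnegative in the others. It is an \<open>S\<close>-module, in which a product that leaves this orthant is \<open>0\<close>.
  Thus \<open>M\<^sub>0 = S\<close>, while \<open>M\<^sub>n\<close> is the top local cohomology module of \<open>S\<close>. Write \<open>H\<^sub>i(M)\<close> for the
  homology of the Koszul complex on \<open>U\<close> with coefficients in \<open>M\<close>. Two facts are combined.

  \<^item> Allowing arbitrary exponents of the variable with index \<open>k\<close> in \<open>M\<^sub>k\<close> gives a module \<open>L\<close>, and there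
    is an exact sequence \<open>0 \<rightarrow> M\<^sub>k \<rightarrow> L \<rightarrow> M\<^bsub>k+1\<^esub> \<rightarrow> 0\<close>. The \<open>c\<close>-th power of that variable lies in \<open>U\<close>
    and acts bijectively on \<open>L\<close>, so the Koszul complex of \<open>L\<close> is contractible, and the connecting map
    is an isomorphism from \<open>H\<^bsub>i+1\<^esub>(M\<^bsub>k+1\<^esub>)\<close> to \<open>H\<^sub>i(M\<^sub>k)\<close> that preserves degrees. In \<open>n\<close> steps
    \<open>H\<^bsub>i+n\<^esub>(M\<^sub>n)\<^sub>j\<close> is identified with \<open>H\<^sub>i(S)\<^sub>j\<close>. The step is \<open>homology_dim_orthant_step\<close>; its core
    is \<open>homology_dim_connecting\<close>, where the connecting map and its inverse are the off-diagonal blocks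
    of the differential and of the contracting homotopy.

  \<^item> Replacing a set of monomials \<open>A\<close> by \<open>U - A\<close> and \<open>x\<^sup>a\<close> by the Laurent monomial with the exponents
    \<open>-1 - a\<close> turns the Koszul complex of \<open>S\<close> into the graded dual of that of \<open>M\<^sub>n\<close>. Since a complex of
    finite-dimensional spaces and its transpose have homology of equal dimension
    (\<open>quot_dim_transpose\<close>), \<open>H\<^sub>i(S)\<^sub>j\<close> and \<open>H\<^bsub>N-i\<^esub>(M\<^sub>n)\<close> in degree \<open>N c - n - j\<close> have the same
    dimension. This is \<open>homology_dim_complement\<close>.

  A basis element \<open>x\<^sup>a e\<^sub>A\<close> is recorded as the pair of \<open>A\<close> and its \<open>\<int>\<^sup>n\<close>-degree \<open>b\<close>, the sum of \<open>a\<close> and of the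
  exponents of the members of \<open>A\<close>. The differential only removes elements from \<open>A\<close>, up to sign, and keeps
  \<open>b\<close>. So the complexes above are pieces of one simplicial chain complex, cut out by the conditions that
  \<open>b\<close> and \<open>A\<close> put on the exponents \<open>a\<close>, and both facts are statements about families of finite sets.
\<close>

section \<open>Dimensions of subquotients of function spaces\<close>

definition fscale :: "'k::field \<Rightarrow> ('x \<Rightarrow> 'k) \<Rightarrow> 'x \<Rightarrow> 'k" where
  "fscale a f = (\<lambda>x. a * f x)"

interpretation fvec: vector_space fscale
  by unfold_locales (auto simp: fscale_def fun_eq_iff algebra_simps)

interpretation fvec_pair: vector_space_pair fscale fscale ..

abbreviation flinear :: "(('x \<Rightarrow> 'k::field) \<Rightarrow> ('y \<Rightarrow> 'k)) \<Rightarrow> bool" where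
  "flinear f \<equiv> Vector_Spaces.linear fscale fscale f"

lemma fscale_apply [simp]: "fscale a f x = a * f x"
  by (simp add: fscale_def)

lemma flinearI:
  assumes "\<And>f g. L (f + g) = L f + L g" "\<And>a f. L (fscale a f) = fscale a (L f)"
  shows "flinear L"
  using assms by unfold_locales auto

lemma flinear_simps:
  assumes "flinear L"
  shows "L (f + g) = L f + L g" "L (f - g) = L f - L g" "L 0 = 0" "L (fscale a f) = fscale a (L f)"
    "L (\<Sum>k\<in>I. h k) = (\<Sum>k\<in>I. L (h k))"
proof -
  interpret Vector_Spaces.linear fscale fscale L by fact
  show "L (f + g) = L f + L g" "L (f - g) = L f - L g" "L 0 = 0" "L (fscale a f) = fscale a (L f)"
    "L (\<Sum>k\<in>I. h k) = (\<Sum>k\<in>I. L (h k))"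
    by (rule add diff zero scale sum)+
qed

lemma sum_fun_apply: "(\<Sum>k\<in>I. f k) x = (\<Sum>k\<in>I. f k x)"
  by (induction I rule: infinite_finite_induct) auto

definition supp_on :: "'x set \<Rightarrow> ('x \<Rightarrow> 'k::field) set" where
  "supp_on X = {f. \<forall>x. x \<notin> X \<longrightarrow> f x = 0}"

lemma subspace_supp_on: "fvec.subspace (supp_on X)"
  by (auto simp: fvec.subspace_def supp_on_def)

lemma subspace_kernel_on:
  "flinear L \<Longrightarrow> fvec.subspace S \<Longrightarrow> fvec.subspace {f \<in> S. L f = 0}"
  by (auto simp: fvec.subspace_def flinear_simps fun_eq_iff)

lemma subspace_image: "flinear L \<Longrightarrow> fvec.subspace S \<Longrightarrow> fvec.subspace (L ` S)"
  by (rule fvec_pair.linear_subspace_image)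

text \<open>A functional that vanishes on the kernel of \<open>L\<close> factors through \<open>L\<close>; composing it with the section \<open>s\<close>
  gives the factor, already extended to the whole target.\<close>

lemma linear_section:
  assumes "flinear L" "fvec.subspace V"
  obtains s where "\<And>v. s v \<in> V" "flinear s" "\<And>v. v \<in> L ` V \<Longrightarrow> L (s v) = v"
proof -
  from fvec_pair.linear_exists_right_inverse_on[OF assms] obtain s
    where "s ` UNIV \<subseteq> V \<and> flinear s \<and> (\<forall>v\<in>L ` V. L (s v) = v)" ..
  then have 1: "range s \<subseteq> V" and 2: "flinear s" and 3: "\<forall>v\<in>L ` V. L (s v) = v"
    by iprover+
  show thesis by (rule that[OF subsetD[OF 1 rangeI] 2 bspec[OF 3]])
qed

text \<open>The dimension of \<open>Z / B\<close>, witnessed by a family in \<open>Z\<close> that is a basis modulo \<open>B\<close>. As a relation it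
  also makes sense when \<open>Z\<close> and \<open>B\<close> are infinite-dimensional, which can happen for the orthants
  between the first and the last one.\<close>

definition quot_dim :: "('x \<Rightarrow> 'k::field) set \<Rightarrow> ('x \<Rightarrow> 'k) set \<Rightarrow> nat \<Rightarrow> bool" where
  "quot_dim Z B d \<longleftrightarrow> (\<exists>e::nat \<Rightarrow> 'x \<Rightarrow> 'k. (\<forall>k<d. e k \<in> Z) \<and>
     (\<forall>z\<in>Z. \<exists>a. z - (\<Sum>k<d. fscale (a k) (e k)) \<in> B) \<and>
     (\<forall>a. (\<Sum>k<d. fscale (a k) (e k)) \<in> B \<longrightarrow> (\<forall>k<d. a k = 0)))"

text \<open>Two linear maps that are inverse to each other modulo \<open>B\<close> and \<open>B'\<close> carry a basis of one quotient to a
  basis of the other. Homotopy equivalences of complexes are used in this form.\<close>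

lemma quot_dim_transfer:
  assumes f: "flinear f" and g: "flinear g"
    and Z: "fvec.subspace Z" and B: "fvec.subspace B" and B': "fvec.subspace B'"
    and fZ: "\<And>z. z \<in> Z \<Longrightarrow> f z \<in> Z'" and gZ: "\<And>z. z \<in> Z' \<Longrightarrow> g z \<in> Z"
    and fB: "\<And>b. b \<in> B \<Longrightarrow> f b \<in> B'" and gB: "\<And>b. b \<in> B' \<Longrightarrow> g b \<in> B"
    and gf: "\<And>z. z \<in> Z \<Longrightarrow> z - g (f z) \<in> B" and fg: "\<And>z. z \<in> Z' \<Longrightarrow> z - f (g z) \<in> B'"
    and d: "quot_dim Z B d"
  shows "quot_dim Z' B' d"
proof -
  obtain e where e: "\<And>k. k < d \<Longrightarrow> e k \<in> Z"
    and sp: "\<And>z. z \<in> Z \<Longrightarrow> \<exists>a. z - (\<Sum>k<d. fscale (a k) (e k)) \<in> B"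
    and ind: "\<And>a. (\<Sum>k<d. fscale (a k) (e k)) \<in> B \<Longrightarrow> (\<forall>k<d. a k = 0)"
    using d unfolding quot_dim_def by blast
  have fsum: "f (\<Sum>k<d. fscale (a k) (e k)) = (\<Sum>k<d. fscale (a k) (f (e k)))" for a
    by (simp add: flinear_simps[OF f])
  have inZ: "(\<Sum>k<d. fscale (a k) (e k)) \<in> Z" for a
    by (intro fvec.subspace_sum[OF Z] fvec.subspace_scale[OF Z] e) auto
  show ?thesis unfolding quot_dim_def
  proof (intro exI[of _ "\<lambda>k. f (e k)"] conjI allI impI ballI)
    fix k assume "k < d" then show "f (e k) \<in> Z'" using e fZ by blast
  next
    fix z assume z: "z \<in> Z'"
    obtain a where a: "g z - (\<Sum>k<d. fscale (a k) (e k)) \<in> B" using sp gZ z by blast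
    have "(z - f (g z)) + f (g z - (\<Sum>k<d. fscale (a k) (e k))) \<in> B'"
      using fg[OF z] fB[OF a] B' by (rule fvec.subspace_add[rotated])
    then show "\<exists>a. z - (\<Sum>k<d. fscale (a k) (f (e k))) \<in> B'"
      by (auto simp: flinear_simps(2)[OF f] fsum)
  next
    fix a k assume a: "(\<Sum>k<d. fscale (a k) (f (e k))) \<in> B'" and k: "k < d"
    let ?s = "\<Sum>k<d. fscale (a k) (e k)"
    have "g (f ?s) \<in> B" using gB[OF a] by (simp add: fsum)
    then have "(?s - g (f ?s)) + g (f ?s) \<in> B"
      using gf[OF inZ] B fvec.subspace_add by blast
    then show "a k = 0" using ind k by auto
  qed
qed

definition delta :: "'x \<Rightarrow> 'x \<Rightarrow> 'k::field" where
  "delta y = (\<lambda>x. if x = y then 1 else 0)"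

lemma supp_on_expand:
  assumes "finite X" "f \<in> supp_on X"
  shows "f = (\<Sum>x\<in>X. fscale (f x) (delta x))"
proof
  fix y
  have "(\<Sum>x\<in>X. f x * delta x y) = (\<Sum>x\<in>X. if y = x then f x else 0)"
    by (intro sum.cong) (auto simp: delta_def)
  also have "\<dots> = f y" using assms by (auto simp: supp_on_def)
  finally show "f y = (\<Sum>x\<in>X. fscale (f x) (delta x)) y"
    by (simp add: sum_fun_apply)
qed

lemma delta_supp_on: "x \<in> X \<Longrightarrow> delta x \<in> supp_on X"
  by (auto simp: supp_on_def delta_def)

text \<open>A basis of \<open>B\<close> extends to a basis of \<open>Z\<close>, and the added vectors form a basis modulo \<open>B\<close>. The finite
  support bounds their number.\<close>

lemma quot_dim_exists:
  assumes X: "finite X" and ZX: "Z \<subseteq> supp_on X"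
    and Z: "fvec.subspace Z" and B: "fvec.subspace B" and BZ: "B \<subseteq> Z"
  shows "\<exists>d. quot_dim Z B d"
proof -
  obtain S where S: "S \<subseteq> B" "fvec.independent S" "B \<subseteq> fvec.span S"
    using fvec.maximal_independent_subset[of B] by metis
  obtain T where T: "S \<subseteq> T" "T \<subseteq> Z" "fvec.independent T" "Z \<subseteq> fvec.span T"
    using fvec.maximal_independent_subset_extend[of S Z] S BZ by (metis subset_trans)
  have spB: "fvec.span S = B" using S B by (metis fvec.span_minimal subset_antisym)
  have "supp_on X \<subseteq> fvec.span (delta ` X :: ('a \<Rightarrow> 'b) set)"
  proof
    fix f :: "'a \<Rightarrow> 'b" assume "f \<in> supp_on X"
    then have "f = (\<Sum>x\<in>X. fscale (f x) (delta x))" using X supp_on_expand by blast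
    also have "\<dots> \<in> fvec.span (delta ` X)"
      by (intro fvec.span_sum fvec.span_scale fvec.span_base) auto
    finally show "f \<in> fvec.span (delta ` X)" .
  qed
  then have finT: "finite T"
    using fvec.independent_span_bound[of "delta ` X" T] X T ZX by blast
  then have finS: "finite S" using T finite_subset by blast
  obtain e where e: "bij_betw e {..<card (T - S)} (T - S)"
    using finT by (metis ex_bij_betw_nat_finite finite_Diff atLeast0LessThan)
  have re: "(\<Sum>k<card (T - S). fscale (a (e k)) (e k)) = (\<Sum>t\<in>T-S. fscale (a t) t)" for a
    by (rule sum.reindex_bij_betw[OF e])
  show ?thesis unfolding quot_dim_def
  proof (intro exI[of _ "card (T - S)"] exI[of _ e] conjI allI impI ballI)
    fix k assume "k < card (T - S)"
    then show "e k \<in> Z" using e T by (auto simp: bij_betw_def)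
  next
    fix z assume "z \<in> Z"
    then obtain u where u: "z = (\<Sum>t\<in>T. fscale (u t) t)"
      using T(4) fvec.span_finite[OF finT] by auto
    have "z = (\<Sum>t\<in>T-S. fscale (u t) t) + (\<Sum>t\<in>S. fscale (u t) t)"
      unfolding u by (rule sum.subset_diff[OF T(1) finT])
    moreover have "(\<Sum>t\<in>S. fscale (u t) t) \<in> B"
      unfolding spB[symmetric] by (intro fvec.span_sum fvec.span_scale fvec.span_base)
    ultimately show "\<exists>a. z - (\<Sum>k<card (T - S). fscale (a k) (e k)) \<in> B"
      by (intro exI[of _ "\<lambda>k. u (e k)"]) (simp only: re add_diff_cancel_left')
  next
    fix a k assume a: "(\<Sum>k<card (T - S). fscale (a k) (e k)) \<in> B" and k: "k < card (T - S)"
    define u where "u t = a (inv_into {..<card (T - S)} e t)" for t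
    have ue: "u (e k) = a k" if "k < card (T - S)" for k
      using that e by (simp add: u_def bij_betw_def inv_into_f_f)
    have eq: "(\<Sum>k<card (T - S). fscale (a k) (e k)) = (\<Sum>t\<in>T-S. fscale (u t) t)"
      unfolding re[symmetric] by (intro sum.cong) (auto simp: ue)
    obtain w where w: "(\<Sum>t\<in>T-S. fscale (u t) t) = (\<Sum>t\<in>S. fscale (w t) t)"
      using a unfolding eq spB[symmetric] fvec.span_finite[OF finS] by auto
    define v where "v t = (if t \<in> S then - w t else u t)" for t
    have "(\<Sum>t\<in>T. fscale (v t) t) = (\<Sum>t\<in>T-S. fscale (v t) t) + (\<Sum>t\<in>S. fscale (v t) t)"
      by (rule sum.subset_diff[OF T(1) finT])
    also have "(\<Sum>t\<in>T-S. fscale (v t) t) = (\<Sum>t\<in>T-S. fscale (u t) t)"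
      by (intro sum.cong) (auto simp: v_def)
    also have "(\<Sum>t\<in>S. fscale (v t) t) = - (\<Sum>t\<in>S. fscale (w t) t)"
      unfolding sum_negf[symmetric] by (intro sum.cong) (auto simp: v_def)
    finally have "(\<Sum>t\<in>T. fscale (v t) t) = 0" by (simp only: w right_minus)
    then have "v (e k) = 0"
      using fvec.independentD[OF T(3) finT subset_refl] e k by (auto simp: bij_betw_def)
    moreover have "e k \<in> T - S" using e k by (auto simp: bij_betw_def)
    ultimately show "a k = 0" using ue[OF k] by (simp add: v_def)
  qed
qed

definition pairing :: "'x set \<Rightarrow> ('x \<Rightarrow> 'k::field) \<Rightarrow> ('x \<Rightarrow> 'k) \<Rightarrow> 'k" where
  "pairing X f g = (\<Sum>x\<in>X. f x * g x)"

lemma pairing_linear: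
  "pairing X (f + f') g = pairing X f g + pairing X f' g"
  "pairing X (f - f') g = pairing X f g - pairing X f' g"
  "pairing X (fscale a f) g = a * pairing X f g"
  "pairing X 0 g = 0"
  "pairing X (\<Sum>k\<in>I. h k) g = (\<Sum>k\<in>I. pairing X (h k) g)"
  "pairing X f (g - g') = pairing X f g - pairing X f g'"
  "pairing X f (fscale a g) = a * pairing X f g"
  "pairing X f 0 = 0"
  "pairing X f (\<Sum>k\<in>I. h k) = (\<Sum>k\<in>I. pairing X f (h k))"
  using sum.swap[of "\<lambda>x k. h k x * g x" I X] sum.swap[of "\<lambda>x k. f x * h k x" I X]
  by (auto simp: pairing_def sum_fun_apply sum.distrib sum_subtractf sum_distrib_left
      sum_distrib_right algebra_simps)

lemma pairing_delta:
  assumes "finite X" "x \<in> X" shows "pairing X (delta x) g = g x"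
proof -
  have "pairing X (delta x) g = (\<Sum>y\<in>X. if x = y then g y else 0)"
    unfolding pairing_def by (intro sum.cong) (auto simp: delta_def)
  then show ?thesis using assms by simp
qed

lemma pairing_nondegenerate:
  assumes "finite X" "g \<in> supp_on X" "g' \<in> supp_on X"
    and "\<And>f. f \<in> supp_on X \<Longrightarrow> pairing X f g = pairing X f g'"
  shows "g = g'"
proof
  fix x show "g x = g' x"
  proof (cases "x \<in> X")
    case True
    then show ?thesis
      using assms(4)[OF delta_supp_on[OF True]] by (simp add: pairing_delta[OF assms(1)])
  qed (use assms(2,3) in \<open>simp add: supp_on_def\<close>)
qed

text \<open>A linear functional is given as one coordinate of a linear map between function spaces, so that the
  scalars need no vector space structure of their own.\<close>

lemma functional_representable:
  assumes "finite X" "flinear L"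
  obtains q where "q \<in> supp_on X" "\<And>f. f \<in> supp_on X \<Longrightarrow> L f y = pairing X f q"
proof
  let ?q = "\<lambda>x. if x \<in> X then L (delta x) y else 0"
  show "?q \<in> supp_on X" by (auto simp: supp_on_def)
  fix f :: "'a \<Rightarrow> 'b" assume f: "f \<in> supp_on X"
  have "L f y = L (\<Sum>x\<in>X. fscale (f x) (delta x)) y"
    using supp_on_expand[OF assms(1) f] by simp
  also have "\<dots> = pairing X f ?q"
    by (simp add: flinear_simps[OF assms(2)] sum_fun_apply pairing_def)
  finally show "L f y = pairing X f ?q" .
qed

text \<open>A three-term complex and its transpose have homology of the same dimension. A basis \<open>e\<close> of the homology
  yields the dual basis: the coordinate functionals with respect to \<open>e\<close> extend to functionals that vanish
  on the boundaries, hence are cocycles. They generate because a functional that vanishes on all cycles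
  factors through \<open>dout\<close> and is therefore a coboundary.\<close>

lemma quot_dim_transpose:
  fixes din :: "('w \<Rightarrow> 'k::field) \<Rightarrow> ('x \<Rightarrow> 'k)" and dout :: "('x \<Rightarrow> 'k) \<Rightarrow> ('y \<Rightarrow> 'k)"
  assumes fin: "finite W" "finite X" "finite Y"
    and lin: "flinear din" "flinear dout"
    and din: "\<And>f. f \<in> supp_on W \<Longrightarrow> din f \<in> supp_on X"
    and dout: "\<And>f. f \<in> supp_on X \<Longrightarrow> dout f \<in> supp_on Y"
    and tin: "\<And>f. f \<in> supp_on X \<Longrightarrow> tin f \<in> supp_on W"
    and tout: "\<And>f. f \<in> supp_on Y \<Longrightarrow> tout f \<in> supp_on X"
    and adj1: "\<And>f g. f \<in> supp_on W \<Longrightarrow> g \<in> supp_on X \<Longrightarrow> pairing X (din f) g = pairing W f (tin g)"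
    and adj2: "\<And>f g. f \<in> supp_on X \<Longrightarrow> g \<in> supp_on Y \<Longrightarrow> pairing Y (dout f) g = pairing X f (tout g)"
    and dd: "\<And>f. f \<in> supp_on W \<Longrightarrow> dout (din f) = 0"
    and d: "quot_dim {f \<in> supp_on X. dout f = 0} (din ` supp_on W) d"
  shows "quot_dim {g \<in> supp_on X. tin g = 0} (tout ` supp_on Y) d"
proof -
  let ?Z = "{f \<in> supp_on X. dout f = 0}" and ?B = "din ` supp_on W"
  obtain e where e: "\<And>k. k < d \<Longrightarrow> e k \<in> ?Z"
    and sp: "\<And>z. z \<in> ?Z \<Longrightarrow> \<exists>a. z - (\<Sum>k<d. fscale (a k) (e k)) \<in> ?B"
    and ind: "\<And>a. (\<Sum>k<d. fscale (a k) (e k)) \<in> ?B \<Longrightarrow> (\<forall>k<d. a k = 0)"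
    using d unfolding quot_dim_def by blast
  note sub = subspace_supp_on
  have B: "fvec.subspace ?B" by (rule subspace_image[OF lin(1) sub])
  \<comment> \<open>A section of this map reads off, for a cycle, its coordinates with respect to \<open>e\<close> in the \<open>Inl\<close> part.\<close>
  define L where "L v = (\<Sum>k<d. fscale (v (Inl k)) (e k)) + din (\<lambda>x. v (Inr x))" for v :: "nat + 'w \<Rightarrow> 'k"
  let ?V = "supp_on (range Inl \<union> Inr ` W) :: (nat + 'w \<Rightarrow> 'k) set"
  have linL: "flinear L"
  proof (rule flinearI)
    fix u v :: "nat + 'w \<Rightarrow> 'k" and a
    have "din (\<lambda>x. u (Inr x) + v (Inr x)) = din (\<lambda>x. u (Inr x)) + din (\<lambda>x. v (Inr x))"
      using flinear_simps(1)[OF lin(1), of "\<lambda>x. u (Inr x)" "\<lambda>x. v (Inr x)"] by (simp add: plus_fun_def)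
    then show "L (u + v) = L u + L v"
      by (simp add: L_def fvec.scale_left_distrib sum.distrib)
    have "din (\<lambda>x. a * u (Inr x)) = fscale a (din (\<lambda>x. u (Inr x)))"
      using flinear_simps(4)[OF lin(1), of a "\<lambda>x. u (Inr x)"] by (simp add: fscale_def)
    then show "L (fscale a u) = fscale a (L u)"
      by (simp add: L_def fvec.scale_right_distrib fvec.scale_sum_right)
  qed
  obtain s where s: "\<And>v. s v \<in> ?V" "flinear s" "\<And>v. v \<in> L ` ?V \<Longrightarrow> L (s v) = v"
    by (rule linear_section[OF linL sub[of "range Inl \<union> Inr ` W"]]) (rule that)
  have inB: "din (\<lambda>x. v (Inr x)) \<in> ?B" if "v \<in> ?V" for v
    using that by (intro imageI) (auto simp: supp_on_def)
  have LZ: "z \<in> L ` ?V" if z: "z - (\<Sum>k<d. fscale (a k) (e k)) \<in> ?B" for z a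
  proof -
    obtain w where w: "w \<in> supp_on W" "z - (\<Sum>k<d. fscale (a k) (e k)) = din w" using z by blast
    have "L (case_sum a w) = z" using w(2) by (simp add: L_def algebra_simps)
    moreover have "case_sum a w \<in> ?V" using w(1) by (auto simp: supp_on_def split: sum.splits)
    ultimately show ?thesis by blast
  qed
  have coord: "s z (Inl k) = a k" if z: "z - (\<Sum>k<d. fscale (a k) (e k)) \<in> ?B" and k: "k < d" for z a k
  proof -
    define w where "w = s z"
    have "z = (\<Sum>k<d. fscale (w (Inl k)) (e k)) + din (\<lambda>x. w (Inr x))"
      using s(3)[OF LZ[OF z]] by (simp add: L_def w_def)
    then have "(\<Sum>k<d. fscale (w (Inl k) - a k) (e k)) =
        (z - (\<Sum>k<d. fscale (a k) (e k))) - din (\<lambda>x. w (Inr x))"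
      by (simp add: fvec.scale_left_diff_distrib sum_subtractf)
    also have "\<dots> \<in> ?B" using fvec.subspace_diff[OF B z inB[OF s(1)]] unfolding w_def .
    finally show ?thesis using ind[of "\<lambda>k. w (Inl k) - a k"] k by (auto simp: w_def)
  qed
  have coord_B: "s b (Inl k) = 0" if "b \<in> ?B" "k < d" for b k
    using coord[of b "\<lambda>_. 0" k] that by simp
  have coord_e: "s (e l) (Inl k) = (if k = l then 1 else 0)" if "l < d" "k < d" for k l
  proof (rule coord)
    have "(\<Sum>k<d. fscale (if k = l then 1 else 0) (e k)) = (\<Sum>k<d. if k = l then e k else 0)"
      by (intro sum.cong) auto
    also have "\<dots> = e l" using that by simp
    finally show "e l - (\<Sum>k<d. fscale (if k = l then 1 else 0) (e k)) \<in> ?B"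
      using fvec.subspace_0[OF B] by simp
  qed (use that in auto)
  have "\<exists>q. q \<in> supp_on X \<and> (\<forall>f\<in>supp_on X. s f (Inl k) = pairing X f q)" for k
    using functional_representable[OF fin(2) s(2)] by metis
  then obtain g where gX: "\<And>k. g k \<in> supp_on X"
    and g: "\<And>k f. f \<in> supp_on X \<Longrightarrow> s f (Inl k) = pairing X f (g k)" by metis
  have ge: "pairing X (e l) (g k) = (if k = l then 1 else 0)" if "l < d" "k < d" for k l
    using coord_e[OF that] g[of "e l" k] e[OF that(1)] by simp
  have pz: "pairing X b h = 0" if h: "h \<in> supp_on X" "tin h = 0" "b \<in> ?B" for b h
  proof -
    obtain w where "w \<in> supp_on W" "b = din w" using h(3) by blast
    then show ?thesis using adj1[of w h] h by (simp add: pairing_linear)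
  qed
  show ?thesis unfolding quot_dim_def
  proof (intro exI[of _ g] conjI allI impI ballI)
    fix k assume k: "k < d"
    have "tin (g k) = 0"
    proof (rule pairing_nondegenerate[OF fin(1)])
      fix f :: "'w \<Rightarrow> 'k" assume f: "f \<in> supp_on W"
      have "pairing W f (tin (g k)) = s (din f) (Inl k)"
        using adj1[OF f gX] g[OF din[OF f]] by simp
      also have "\<dots> = 0" using coord_B f k by blast
      finally show "pairing W f (tin (g k)) = pairing W f 0" by (simp add: pairing_linear)
    qed (simp_all add: tin gX fvec.subspace_0[OF sub])
    then show "g k \<in> {g \<in> supp_on X. tin g = 0}" using gX by simp
  next
    fix h assume h: "h \<in> {g \<in> supp_on X. tin g = 0}"
    \<comment> \<open>Subtracting the combination of the \<open>g k\<close> with the same values on the \<open>e k\<close> leaves a functional that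
      vanishes on all cycles.\<close>
    define h' where "h' = h - (\<Sum>k<d. fscale (pairing X (e k) h) (g k))"
    have h'X: "h' \<in> supp_on X" unfolding h'_def
      by (intro fvec.subspace_diff[OF sub] fvec.subspace_sum[OF sub] fvec.subspace_scale[OF sub])
        (use h gX in auto)
    have van: "pairing X z h' = 0" if z: "z \<in> ?Z" for z
    proof -
      obtain a where a: "z - (\<Sum>k<d. fscale (a k) (e k)) \<in> ?B" using sp[OF z] by blast
      have zk: "pairing X z (g k) = a k" if "k < d" for k
        using coord[OF a that] g[of z k] z by simp
      have "pairing X (z - (\<Sum>k<d. fscale (a k) (e k))) h = 0" using pz h a by blast
      then have "pairing X z h = (\<Sum>k<d. a k * pairing X (e k) h)"
        by (simp add: pairing_linear)
      then show ?thesis unfolding h'_def by (simp add: pairing_linear zk mult.commute)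
    qed
    obtain r where r: "\<And>v. r v \<in> supp_on X" "flinear r" "\<And>v. v \<in> dout ` supp_on X \<Longrightarrow> dout (r v) = v"
      by (rule linear_section[OF lin(2) sub[of X]]) (rule that)
    have "flinear (\<lambda>y (_::unit). pairing X (r y) h')"
      by (rule flinearI) (auto simp: flinear_simps[OF r(2)] pairing_linear fun_eq_iff)
    from functional_representable[OF fin(3) this] obtain q where q: "q \<in> supp_on Y"
      "\<And>f. f \<in> supp_on Y \<Longrightarrow> pairing X (r f) h' = pairing Y f q" by metis
    have "tout q = h'"
    proof (rule pairing_nondegenerate[OF fin(2)])
      fix f :: "'x \<Rightarrow> 'k" assume f: "f \<in> supp_on X"
      have "f - r (dout f) \<in> ?Z"
        using f fvec.subspace_diff[OF sub f r(1)] r(3) by (simp add: flinear_simps[OF lin(2)])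
      then have "pairing X f h' = pairing X (r (dout f)) h'"
        using van by (fastforce simp: pairing_linear)
      then show "pairing X f (tout q) = pairing X f h'"
        using adj2[OF f q(1)] q(2)[OF dout[OF f]] by simp
    qed (use tout q h'X in auto)
    then show "\<exists>a. h - (\<Sum>k<d. fscale (a k) (g k)) \<in> tout ` supp_on Y"
      using q(1) unfolding h'_def
      by (intro exI[of _ "\<lambda>k. pairing X (e k) h"] image_eqI[of _ tout q]) simp_all
  next
    fix a l assume a: "(\<Sum>k<d. fscale (a k) (g k)) \<in> tout ` supp_on Y" and l: "l < d"
    then obtain q where q: "q \<in> supp_on Y" "(\<Sum>k<d. fscale (a k) (g k)) = tout q" by blast
    have "pairing X (e l) (tout q) = 0"
      using adj2[of "e l" q] q(1) e[OF l] by (simp add: pairing_linear pairing_def)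
    moreover have "pairing X (e l) (\<Sum>k<d. fscale (a k) (g k)) = a l"
    proof -
      have "pairing X (e l) (\<Sum>k<d. fscale (a k) (g k)) = (\<Sum>k<d. a k * pairing X (e l) (g k))"
        by (simp add: pairing_linear)
      also have "\<dots> = (\<Sum>k<d. if k = l then a k else 0)"
        by (intro sum.cong) (auto simp: ge l)
      finally show ?thesis using l by simp
    qed
    ultimately show "a l = 0" using q(2) by simp
  qed
qed

section \<open>Graded complexes on families of cells\<close>

definition restr :: "'x set \<Rightarrow> ('x \<Rightarrow> 'k::field) \<Rightarrow> 'x \<Rightarrow> 'k" where
  "restr F f = (\<lambda>x. if x \<in> F then f x else 0)"

lemma restr_simps [simp]:
  "restr F (f + g) = restr F f + restr F g" "restr F (f - g) = restr F f - restr F g"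
  "restr F (fscale a f) = fscale a (restr F f)" "restr F 0 = 0"
  by (auto simp: restr_def fun_eq_iff)

lemma restr_in_supp_on [simp]: "restr F f \<in> supp_on F"
  by (auto simp: restr_def supp_on_def)

lemma restr_id: "f \<in> supp_on F \<Longrightarrow> restr F f = f"
  by (auto simp: restr_def supp_on_def fun_eq_iff)

lemma restr_disjoint: "f \<in> supp_on G \<Longrightarrow> F \<inter> G = {} \<Longrightarrow> restr F f = 0"
  by (auto simp: restr_def supp_on_def fun_eq_iff)

lemma supp_on_mono: "f \<in> supp_on F \<Longrightarrow> F \<subseteq> G \<Longrightarrow> f \<in> supp_on G"
  by (auto simp: supp_on_def)

lemma restr_split:
  "f \<in> supp_on (F \<union> G) \<Longrightarrow> F \<inter> G = {} \<Longrightarrow> f = restr F f + restr G f"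
  by (auto simp: restr_def supp_on_def fun_eq_iff)

text \<open>A cell consists of a vertex set and of a second component that the differentials do not change; it
  will be a multidegree.\<close>

type_synonym ('v, 'p) cell = "'v set \<times> 'p"

definition level :: "int \<Rightarrow> ('v, 'p) cell set \<Rightarrow> ('v, 'p) cell set" where
  "level i F = {x \<in> F. int (card (fst x)) = i}"

text \<open>A family of cells \<open>F\<close> carries the complex of all functions supported on \<open>F\<close>, with the part of \<open>D\<close>
  that stays inside \<open>F\<close> as its differential. For infinite \<open>F\<close> these are products where the
  corresponding modules have direct sums; only the finite families matter in the end.\<close>

definition cycles_on :: "((('v, 'p) cell \<Rightarrow> 'k::field) \<Rightarrow> ('v, 'p) cell \<Rightarrow> 'k) \<Rightarrow> ('v, 'p) cell set \<Rightarrow> int \<Rightarrow> _ set" where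
  "cycles_on D F i = {f \<in> supp_on (level i F). restr F (D f) = 0}"

definition boundaries_on :: "((('v, 'p) cell \<Rightarrow> 'k::field) \<Rightarrow> ('v, 'p) cell \<Rightarrow> 'k) \<Rightarrow> ('v, 'p) cell set \<Rightarrow> int \<Rightarrow> _ set" where
  "boundaries_on D F i = (\<lambda>f. restr F (D f)) ` supp_on (level (i + 1) F)"

definition homology_dim :: "((('v, 'p) cell \<Rightarrow> 'k::field) \<Rightarrow> ('v, 'p) cell \<Rightarrow> 'k) \<Rightarrow> ('v, 'p) cell set \<Rightarrow> int \<Rightarrow> nat \<Rightarrow> bool" where
  "homology_dim D F i d \<longleftrightarrow> quot_dim (cycles_on D F i) (boundaries_on D F i) d"

lemma level_subset: "level i F \<subseteq> F" by (auto simp: level_def)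

lemma flinear_restr: "flinear D \<Longrightarrow> flinear (\<lambda>f. restr F (D f))"
  by (rule flinearI) (simp_all only: flinear_simps restr_simps)

lemma subspace_cycles_on: "flinear D \<Longrightarrow> fvec.subspace (cycles_on D F i)"
  unfolding cycles_on_def by (intro subspace_kernel_on flinear_restr subspace_supp_on)

lemma subspace_boundaries_on: "flinear D \<Longrightarrow> fvec.subspace (boundaries_on D F i)"
  unfolding boundaries_on_def by (intro subspace_image flinear_restr subspace_supp_on)

lemma restr_level: "f \<in> supp_on (level i F) \<Longrightarrow> G \<subseteq> F \<Longrightarrow> restr G f \<in> supp_on (level i G)"
  by (auto simp: restr_def supp_on_def level_def)

section \<open>The connecting isomorphism of a contractible complex\<close>

text \<open>Let a contractible complex split into a subcomplex on \<open>Fl\<close> and the quotient complex on \<open>Fu\<close>, with a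
  contraction \<open>H\<close>. The block \<open>\<phi>\<close> of \<open>D\<close> from \<open>Fu\<close> to \<open>Fl\<close> represents the connecting map, and the block
  \<open>\<psi>\<close> of \<open>H\<close> from \<open>Fl\<close> to \<open>Fu\<close> represents its inverse: the blocks of \<open>DD = 0\<close> and of \<open>DH + HD = 1\<close> say
  that both commute with the differentials up to sign and that \<open>\<phi>\<psi>\<close> and \<open>\<psi>\<phi>\<close> are homotopic to the
  identity.\<close>

lemma homology_dim_connecting:
  fixes D H :: "(('v, 'p) cell \<Rightarrow> 'k::field) \<Rightarrow> ('v, 'p) cell \<Rightarrow> 'k"
  assumes D: "flinear D" and H: "flinear H"
    and F: "Fl \<union> Fu = F" "Fl \<inter> Fu = {}"
    and lD: "\<And>i f. f \<in> supp_on (level i F) \<Longrightarrow> D f \<in> supp_on (level (i - 1) F)"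
    and lH: "\<And>i f. f \<in> supp_on (level i F) \<Longrightarrow> H f \<in> supp_on (level (i + 1) F)"
    and DF: "\<And>f. f \<in> supp_on F \<Longrightarrow> D f \<in> supp_on F"
    and HF: "\<And>f. f \<in> supp_on F \<Longrightarrow> H f \<in> supp_on F"
    and DD: "\<And>f. f \<in> supp_on F \<Longrightarrow> D (D f) = 0"
    and DH: "\<And>f. f \<in> supp_on F \<Longrightarrow> D (H f) + H (D f) = f"
    and low: "\<And>f. f \<in> supp_on Fl \<Longrightarrow> D f \<in> supp_on Fl"
    and d: "homology_dim D Fu (i + 1) d"
  shows "homology_dim D Fl i d"
proof -
  let ?r1 = "restr Fl" and ?r2 = "restr Fu"
  define \<phi> where "\<phi> f = ?r1 (D f)" for f
  define \<psi> where "\<psi> f = ?r2 (H f)" for f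
  have sub: "Fl \<subseteq> F" "Fu \<subseteq> F" using F by auto
  note mono = supp_on_mono[OF _ sub(1)] supp_on_mono[OF _ sub(2)]
  have lin: "flinear \<phi>" "flinear \<psi>" unfolding \<phi>_def \<psi>_def by (intro flinear_restr D H)+
  note ls = flinear_simps[OF D] flinear_simps[OF H]
  have split: "f = ?r1 f + ?r2 f" if "f \<in> supp_on F" for f
    using restr_split[of f Fl Fu] that F by simp
  have r1D: "?r1 (D f) = D f" if "f \<in> supp_on Fl" for f using restr_id[OF low[OF that]] .
  have r2D: "?r2 (D f) = 0" if "f \<in> supp_on Fl" for f
    using restr_disjoint[OF low[OF that], of Fu] F by blast
  \<comment> \<open>The block of \<open>DD = 0\<close> from \<open>Fu\<close> to \<open>Fl\<close>.\<close>
  have a: "D (\<phi> f) + \<phi> (?r2 (D f)) = 0" if f: "f \<in> supp_on Fu" for f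
  proof -
    have "D f = \<phi> f + ?r2 (D f)" unfolding \<phi>_def by (rule split) (intro DF mono f)
    then have "D (D f) = D (\<phi> f) + D (?r2 (D f))" using ls(1) by metis
    then have "?r1 (D (\<phi> f)) + ?r1 (D (?r2 (D f))) = 0"
      using DD[OF mono(2)[OF f]] by (metis restr_simps(1,4))
    then show ?thesis using r1D[of "\<phi> f"] by (simp add: \<phi>_def)
  qed
  have r2DH: "?r2 (D (H f)) = ?r2 (D (?r2 (H f)))" if f: "f \<in> supp_on F" for f
  proof -
    have "D (H f) = D (?r1 (H f)) + D (?r2 (H f))"
      using split[OF HF[OF f]] ls(1) by metis
    then show ?thesis using r2D[of "?r1 (H f)"] by simp
  qed
  \<comment> \<open>The block of \<open>DH + HD = 1\<close> from \<open>Fl\<close> to \<open>Fu\<close>.\<close>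
  have b: "\<psi> (D f) + ?r2 (D (\<psi> f)) = 0" if f: "f \<in> supp_on Fl" for f
  proof -
    have "?r2 (D (H f)) + ?r2 (H (D f)) = ?r2 f"
      using DH[OF mono(1)[OF f]] restr_simps(1) by metis
    moreover have "?r2 f = 0" using restr_disjoint[OF f, of Fu] F by blast
    ultimately show ?thesis using r2DH[OF mono(1)[OF f]] by (simp add: \<psi>_def add.commute)
  qed
  \<comment> \<open>The two diagonal blocks of \<open>DH + HD = 1\<close>.\<close>
  have c: "f - \<phi> (\<psi> f) = D (?r1 (H f)) + ?r1 (H (D f))" if f: "f \<in> supp_on Fl" for f
  proof -
    have "D (H f) = D (?r1 (H f)) + D (\<psi> f)"
      using split[OF HF[OF mono(1)[OF f]]] ls(1) unfolding \<psi>_def by metis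
    moreover have "?r1 (D (H f)) + ?r1 (H (D f)) = f"
      using DH[OF mono(1)[OF f]] restr_simps(1) restr_id[OF f] by metis
    ultimately have "D (?r1 (H f)) + \<phi> (\<psi> f) + ?r1 (H (D f)) = f"
      using r1D[of "?r1 (H f)"] by (simp add: \<phi>_def)
    then show ?thesis by (simp add: algebra_simps)
  qed
  have e: "f - \<psi> (\<phi> f) = ?r2 (D (?r2 (H f))) + ?r2 (H (?r2 (D f)))" if f: "f \<in> supp_on Fu" for f
  proof -
    have "H (D f) = H (\<phi> f) + H (?r2 (D f))"
      using split[OF DF[OF mono(2)[OF f]]] ls(6) unfolding \<phi>_def by metis
    moreover have "?r2 (D (H f)) + ?r2 (H (D f)) = f"
      using DH[OF mono(2)[OF f]] restr_simps(1) restr_id[OF f] by metis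
    ultimately have "?r2 (D (?r2 (H f))) + \<psi> (\<phi> f) + ?r2 (H (?r2 (D f))) = f"
      using r2DH[OF mono(2)[OF f]] by (simp add: \<psi>_def add.assoc)
    then show ?thesis by (simp add: algebra_simps)
  qed
  note lmono = supp_on_mono[OF _ level_subset]
  have lev1: "f \<in> supp_on (level i F)" if "f \<in> supp_on (level i Fl)" for f :: "('v, 'p) cell \<Rightarrow> 'k" and i
    using that sub by (auto simp: supp_on_def level_def)
  have lev2: "f \<in> supp_on (level i F)" if "f \<in> supp_on (level i Fu)" for f :: "('v, 'p) cell \<Rightarrow> 'k" and i
    using that sub by (auto simp: supp_on_def level_def)
  have lphi: "\<phi> f \<in> supp_on (level i Fl)" if "f \<in> supp_on (level (i + 1) Fu)" for f i
    unfolding \<phi>_def using restr_level[OF lD[OF lev2[OF that]] sub(1)] by simp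
  have lpsi: "\<psi> f \<in> supp_on (level (i + 1) Fu)" if "f \<in> supp_on (level i Fl)" for f i
    unfolding \<psi>_def using restr_level[OF lH[OF lev1[OF that]] sub(2)] .
  have neg: "(x::('v, 'p) cell \<Rightarrow> 'k) = - y" if "y + x = 0" for x y using that by (metis add.inverse_unique)
  have uminus: "- f = fscale (-1) f" for f :: "('v, 'p) cell \<Rightarrow> 'k" by (simp add: fun_eq_iff)
  have negsupp: "- f \<in> supp_on X" if "f \<in> supp_on X" for f :: "('v, 'p) cell \<Rightarrow> 'k" and X
    using that by (auto simp: supp_on_def)
  have Dneg: "- D f = D (- f)" for f by (simp only: uminus ls)
  show ?thesis unfolding homology_dim_def
  proof (rule quot_dim_transfer[OF lin])
    fix z assume "z \<in> cycles_on D Fu (i + 1)"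
    then have z: "z \<in> supp_on (level (i + 1) Fu)" "?r2 (D z) = 0" by (auto simp: cycles_on_def)
    note z' = lmono[OF z(1)]
    have "D (\<phi> z) = 0" using a[OF z'] z(2) flinear_simps(3)[OF lin(1)] by simp
    then show "\<phi> z \<in> cycles_on D Fl i" using lphi[OF z(1)] by (simp add: cycles_on_def)
    have "?r2 (H z) \<in> supp_on (level (i + 1 + 1) Fu)"
      using restr_level[OF lH[OF lev2[OF z(1)]] sub(2)] .
    moreover have "z - \<psi> (\<phi> z) = ?r2 (D (?r2 (H z)))"
      using e[OF z'] z(2) ls by simp
    ultimately show "z - \<psi> (\<phi> z) \<in> boundaries_on D Fu (i + 1)"
      by (auto simp: boundaries_on_def)
  next
    fix z assume "z \<in> cycles_on D Fl i"
    then have z: "z \<in> supp_on (level i Fl)" "?r1 (D z) = 0" by (auto simp: cycles_on_def)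
    note z' = lmono[OF z(1)]
    have Dz: "D z = 0" using r1D[OF z'] z(2) by simp
    have "?r2 (D (\<psi> z)) = 0" using b[OF z'] Dz flinear_simps(3)[OF lin(2)] by simp
    then show "\<psi> z \<in> cycles_on D Fu (i + 1)" using lpsi[OF z(1)] by (simp add: cycles_on_def)
    have "?r1 (H z) \<in> supp_on (level (i + 1) Fl)"
      using restr_level[OF lH[OF lev1[OF z(1)]] sub(1)] .
    moreover have "z - \<phi> (\<psi> z) = ?r1 (D (?r1 (H z)))"
      using c[OF z'] Dz ls r1D[of "?r1 (H z)"] by simp
    ultimately show "z - \<phi> (\<psi> z) \<in> boundaries_on D Fl i"
      by (auto simp: boundaries_on_def)
  next
    fix y assume "y \<in> boundaries_on D Fu (i + 1)"
    then obtain w where w: "w \<in> supp_on (level (i + 1 + 1) Fu)" "y = ?r2 (D w)"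
      by (auto simp: boundaries_on_def)
    have "\<phi> y = D (- \<phi> w)" using neg[OF a[OF lmono[OF w(1)]]] w(2) Dneg by metis
    moreover have m: "- \<phi> w \<in> supp_on (level (i + 1) Fl)" using negsupp[OF lphi[OF w(1)]] .
    ultimately have "\<phi> y = ?r1 (D (- \<phi> w))" using r1D[OF lmono[OF m]] by simp
    then show "\<phi> y \<in> boundaries_on D Fl i" using m unfolding boundaries_on_def by blast
  next
    fix y assume "y \<in> boundaries_on D Fl i"
    then obtain w where w: "w \<in> supp_on (level (i + 1) Fl)" "y = ?r1 (D w)"
      by (auto simp: boundaries_on_def)
    have "y = D w" using w r1D[OF lmono[OF w(1)]] by simp
    then have "?r2 (D (\<psi> w)) = - \<psi> y" using neg[OF b[OF lmono[OF w(1)]]] by simp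
    moreover have "?r2 (D (- \<psi> w)) = - ?r2 (D (\<psi> w))"
      by (simp only: uminus ls restr_simps)
    ultimately have "\<psi> y = ?r2 (D (- \<psi> w))" by simp
    moreover have "- \<psi> w \<in> supp_on (level (i + 1 + 1) Fu)" using negsupp[OF lpsi[OF w(1)]] .
    ultimately show "\<psi> y \<in> boundaries_on D Fu (i + 1)" unfolding boundaries_on_def by blast
  qed (use d D in \<open>auto simp: subspace_cycles_on subspace_boundaries_on homology_dim_def\<close>)
qed

section \<open>The simplicial differential and its signs\<close>

text \<open>The sign of \<open>e\<^sub>B\<close> in the boundary of \<open>e\<^sub>A\<close> for \<open>A = B \<union> {v}\<close>, as a function of the smaller set.\<close>

definition ins_sign :: "'v::linorder \<Rightarrow> 'v set \<Rightarrow> 'k::field" where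
  "ins_sign v B = (-1) ^ card {w \<in> B. w < v}"

lemma ins_sign_square [simp]: "ins_sign v B * ins_sign v B = 1"
  by (simp add: ins_sign_def flip: power_add mult_2)

lemma ins_sign_square' [simp]: "ins_sign v B * (ins_sign v B * x) = x"
  by (simp flip: mult.assoc)

lemma ins_sign_insert:
  assumes "finite B" "v \<notin> B"
  shows "ins_sign w (insert v B) = (if v < w then - ins_sign w B else ins_sign w B)"
proof -
  have "{x \<in> insert v B. x < w} = (if v < w then insert v {x \<in> B. x < w} else {x \<in> B. x < w})"
    by auto
  then show ?thesis using assms by (simp add: ins_sign_def)
qed

lemma ins_sign_swap:
  assumes "finite B" "v \<notin> B" "w \<notin> B" "v \<noteq> w"
  shows "ins_sign v B * ins_sign w (insert v B) = - (ins_sign w B * ins_sign v (insert w B))"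
  using assms by (cases v w rule: linorder_cases) (auto simp: ins_sign_insert)

text \<open>The Koszul differential in coordinates: the coefficient of \<open>e\<^sub>B\<close> collects the coefficients of the sets
  that have one element more. The factors \<open>m\<^sub>k\<close> are absorbed by the fixed multidegree \<open>b\<close>.\<close>

definition bd :: "'v::linorder set \<Rightarrow> (('v, 'p) cell \<Rightarrow> 'k::field) \<Rightarrow> ('v, 'p) cell \<Rightarrow> 'k" where
  "bd U f = (\<lambda>(B, b). \<Sum>v\<in>U - B. ins_sign v B * f (insert v B, b))"

text \<open>Wedge product with \<open>e\<^sub>v\<close> on the left, at constant multidegree: the Laurent monomial is divided by \<open>v\<close>.\<close>

definition cone :: "'v::linorder \<Rightarrow> (('v, 'p) cell \<Rightarrow> 'k::field) \<Rightarrow> ('v, 'p) cell \<Rightarrow> 'k" where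
  "cone v f = (\<lambda>(A, b). if v \<in> A then ins_sign v (A - {v}) * f (A - {v}, b) else 0)"

lemma flinear_bd: "flinear (bd U)"
  by (rule flinearI) (auto simp: bd_def fun_eq_iff algebra_simps sum.distrib sum_distrib_left)

lemma flinear_cone: "flinear (cone v)"
  by (rule flinearI) (auto simp: cone_def fun_eq_iff algebra_simps)

text \<open>The two ways of adding \<open>v\<close> and \<open>w\<close> to \<open>B\<close> have opposite signs. They are matched explicitly, since in
  characteristic \<open>2\<close> antisymmetry of the double sum would not suffice.\<close>

lemma bd_bd:
  fixes f :: "('v::linorder, 'p) cell \<Rightarrow> 'k::field"
  assumes "finite U" "B \<subseteq> U"
  shows "bd U (bd U f) (B, b) = 0"
proof -
  have finB: "finite B" using assms finite_subset by blast
  define t :: "'v \<times> 'v \<Rightarrow> 'k" where "t = (\<lambda>(v, w). ins_sign v B * ins_sign w (insert v B) * f (insert w (insert v B), b))"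
  define P where "P = {(v, w) \<in> (U - B) \<times> (U - B). v < w}"
  define Q where "Q = {(v, w) \<in> (U - B) \<times> (U - B). w < v}"
  have fin: "finite P" "finite Q"
    using assms(1) finite_subset[of P "(U - B) \<times> (U - B)"] finite_subset[of Q "(U - B) \<times> (U - B)"]
    by (auto simp: P_def Q_def)
  have "bd U (bd U f) (B, b) = (\<Sum>v\<in>U - B. \<Sum>w\<in>U - insert v B. t (v, w))"
    by (simp add: bd_def sum_distrib_left t_def mult.assoc)
  also have "\<dots> = sum t (SIGMA v:U - B. U - insert v B)"
    using assms(1) by (subst sum.Sigma) auto
  also have "(SIGMA v:U - B. U - insert v B) = P \<union> Q"
    by (auto simp: P_def Q_def)
  also have "sum t (P \<union> Q) = sum t P + sum t Q"
    by (rule sum.union_disjoint) (use fin in \<open>auto simp: P_def Q_def\<close>)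
  also have "sum t Q = sum (t \<circ> prod.swap) P"
    by (rule sum.reindex_cong[of prod.swap]) (auto simp: P_def Q_def inj_on_def image_iff)
  also have "\<dots> = - sum t P" unfolding sum_negf[symmetric]
  proof (rule sum.cong[OF refl])
    fix x assume "x \<in> P"
    then obtain v w where x: "x = (v, w)" "v \<notin> B" "w \<notin> B" "v \<noteq> w" by (auto simp: P_def)
    then show "(t \<circ> prod.swap) x = - t x"
      using ins_sign_swap[OF finB, of v w, where ?'b = 'k] by (simp add: t_def insert_commute)
  qed
  finally show ?thesis by simp
qed

text \<open>The cone is a contracting homotopy. For \<open>u \<notin> B\<close> only the vertex \<open>u\<close> contributes, and for \<open>u \<in> B\<close> all
  other vertices contribute twice, with opposite signs.\<close>

lemma bd_cone:
  fixes f :: "('v::linorder, 'p) cell \<Rightarrow> 'k::field"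
  assumes "finite U" "B \<subseteq> U" "u \<in> U"
  shows "bd U (cone u f) (B, b) + cone u (bd U f) (B, b) = f (B, b)"
proof (cases "u \<in> B")
  case False
  have "bd U (cone u f) (B, b) = (\<Sum>v\<in>U - B. if v = u then f (B, b) else 0)"
    unfolding bd_def cone_def prod.case
  proof (rule sum.cong[OF refl])
    fix v assume "v \<in> U - B"
    then show "ins_sign v B * (if u \<in> insert v B then ins_sign u (insert v B - {u}) * f (insert v B - {u}, b) else 0)
       = (if v = u then f (B, b) else 0)" using False by auto
  qed
  then show ?thesis using False assms by (simp add: cone_def)
next
  case True
  define C where "C = B - {u}"
  have B: "B = insert u C" "u \<notin> C" using True by (auto simp: C_def)
  have finC: "finite C" using assms finite_subset C_def by blast
  have UC: "U - C = insert u (U - B)" using B assms by auto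
  have "cone u (bd U f) (B, b) = ins_sign u C * (\<Sum>v\<in>U - C. ins_sign v C * f (insert v C, b))"
    using True by (simp add: cone_def bd_def C_def)
  also have "\<dots> = f (B, b) + (\<Sum>v\<in>U - B. ins_sign u C * (ins_sign v C * f (insert v C, b)))"
    unfolding UC using assms B by (simp add: sum_distrib_left distrib_left)
  also have "(\<Sum>v\<in>U - B. ins_sign u C * (ins_sign v C * f (insert v C, b))) = - bd U (cone u f) (B, b)"
    unfolding bd_def cone_def prod.case sum_negf[symmetric]
  proof (rule sum.cong[OF refl])
    fix v assume "v \<in> U - B"
    then have v: "v \<notin> C" "v \<noteq> u" "insert v B - {u} = insert v C" "u \<in> insert v B" using B by auto
    have "ins_sign u C * (ins_sign v C * x) = - (ins_sign v (insert u C) * (ins_sign u (insert v C) * x))" for x :: 'k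
      using v(2) by (cases u v rule: linorder_cases)
        (simp_all add: ins_sign_insert[OF finC B(2)] ins_sign_insert[OF finC v(1)] mult.left_commute)
    then show "ins_sign u C * (ins_sign v C * f (insert v C, b)) = - (ins_sign v B *
      (if u \<in> insert v B then ins_sign u (insert v B - {u}) * f (insert v B - {u}, b) else 0))"
      using v(3,4) B(1) by simp
  qed
  finally show ?thesis by simp
qed

section \<open>Convex families of cells\<close>

text \<open>Convexity holds for subquotients of the full complex: the boundary of the boundary inside \<open>F\<close> misses no
  intermediate cell.\<close>

definition convex_cells :: "('v, 'p) cell set \<Rightarrow> bool" where
  "convex_cells F \<longleftrightarrow> (\<forall>A B C b. (A, b) \<in> F \<longrightarrow> (C, b) \<in> F \<longrightarrow> A \<subseteq> B \<longrightarrow> B \<subseteq> C \<longrightarrow> (B, b) \<in> F)"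

lemma bd_supp_imp:
  fixes f :: "('v::linorder, 'p) cell \<Rightarrow> 'k::field"
  assumes "f \<in> supp_on F" "bd U f (B, b) \<noteq> 0"
  obtains v where "v \<in> U - B" "(insert v B, b) \<in> F"
proof -
  obtain v where v: "v \<in> U - B" "ins_sign v B * f (insert v B, b) \<noteq> 0"
    using assms(2) unfolding bd_def prod.case by (meson sum.neutral)
  then have "f (insert v B, b) \<noteq> 0" by auto
  then have "(insert v B, b) \<in> F" using assms(1) by (auto simp: supp_on_def)
  then show thesis using that v by blast
qed

lemma bd_level:
  fixes f :: "('v::linorder, 'p) cell \<Rightarrow> 'k::field"
  assumes U: "finite U" and F: "F \<subseteq> Pow U \<times> UNIV" and f: "f \<in> supp_on (level i F)"
  shows "restr F (bd U f) \<in> supp_on (level (i - 1) F)"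
  unfolding supp_on_def
proof (intro CollectI allI impI, rule ccontr)
  fix x assume x: "x \<notin> level (i - 1) F" "restr F (bd U f) x \<noteq> 0"
  obtain B b where Bb: "x = (B, b)" by (cases x)
  have xF: "(B, b) \<in> F" and nz: "bd U f (B, b) \<noteq> 0"
    using x(2) Bb by (auto simp: restr_def split: if_splits)
  obtain v where v: "v \<in> U - B" "(insert v B, b) \<in> level i F" using bd_supp_imp[OF f nz] .
  have "finite B" using xF F U finite_subset by blast
  then have "int (card B) = i - 1" using v by (simp add: level_def)
  then show False using x(1) xF Bb by (simp add: level_def)
qed

lemma bd_restr_bd:
  fixes f :: "('v::linorder, 'p) cell \<Rightarrow> 'k::field"
  assumes U: "finite U" and F: "F \<subseteq> Pow U \<times> UNIV" and conv: "convex_cells F" and f: "f \<in> supp_on F"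
  shows "restr F (bd U (restr F (bd U f))) = 0"
proof
  fix x :: "('v, 'p) cell"
  obtain B b where Bb: "x = (B, b)" by (cases x)
  show "restr F (bd U (restr F (bd U f))) x = 0 x"
  proof (cases "x \<in> F")
    case True
    have "restr F (bd U f) (insert v B, b) = bd U f (insert v B, b)" for v
    proof (rule ccontr)
      assume neq: "restr F (bd U f) (insert v B, b) \<noteq> bd U f (insert v B, b)"
      then have nF: "(insert v B, b) \<notin> F" and nz: "bd U f (insert v B, b) \<noteq> 0"
        by (auto simp: restr_def split: if_splits)
      obtain w where "(insert w (insert v B), b) \<in> F" using bd_supp_imp[OF f nz] by blast
      then show False using conv True Bb nF unfolding convex_cells_def by blast
    qed
    then have "bd U (restr F (bd U f)) (B, b) = bd U (bd U f) (B, b)" by (simp add: bd_def)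
    also have "\<dots> = 0" by (rule bd_bd[OF U]) (use True Bb F in auto)
    finally show ?thesis using True Bb by (simp add: restr_def)
  qed (simp add: restr_def)
qed

lemma homology_dim_restr_cong:
  assumes "F \<subseteq> G"
  shows "homology_dim (\<lambda>f. restr G (D f)) F i d = homology_dim D F i d"
proof -
  have "restr F (restr G g) = restr F g" for g :: "('a, 'b) cell \<Rightarrow> 'c"
    using assms by (auto simp: restr_def fun_eq_iff)
  then show ?thesis by (simp add: homology_dim_def cycles_on_def boundaries_on_def)
qed

text \<open>The complex of \<open>F\<close> is contracted by the cone with apex \<open>u\<close>, and \<open>Fl\<close> spans a subcomplex because it is
  closed under passing to subsets inside \<open>F\<close>.\<close>

lemma homology_dim_cone_step:
  fixes F Fl Fu :: "('v::linorder, 'p) cell set"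
  assumes U: "finite U" "u \<in> U" and FU: "F \<subseteq> Pow U \<times> UNIV" and conv: "convex_cells F"
    and F: "Fl \<union> Fu = F" "Fl \<inter> Fu = {}"
    and cone: "\<And>A b. (A, b) \<in> F \<Longrightarrow> (insert u A, b) \<in> F \<and> (A - {u}, b) \<in> F"
    and lower: "\<And>A B b. (A, b) \<in> Fl \<Longrightarrow> (B, b) \<in> F \<Longrightarrow> B \<subseteq> A \<Longrightarrow> (B, b) \<in> Fl"
    and d: "homology_dim (bd U :: _ \<Rightarrow> _ \<Rightarrow> 'k::field) Fu (i + 1) d"
  shows "homology_dim (bd U :: _ \<Rightarrow> _ \<Rightarrow> 'k::field) Fl i d"
proof -
  let ?D = "\<lambda>f. restr F (bd U f) :: _ \<Rightarrow> 'k" and ?H = "\<lambda>f. restr F (cone u f) :: _ \<Rightarrow> 'k"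
  have coneF: "cone u f \<in> supp_on F" if "f \<in> supp_on F" for f :: "('v, 'p) cell \<Rightarrow> 'k"
    unfolding supp_on_def
  proof (intro CollectI allI impI)
    fix x assume x: "x \<notin> F"
    obtain A b where Ab: "x = (A, b)" by (cases x)
    have "(A - {u}, b) \<notin> F" if "u \<in> A" using cone[of "A - {u}" b] x Ab that by (auto simp: insert_absorb)
    then show "cone u f x = 0" using that Ab by (auto simp: cone_def supp_on_def)
  qed
  have "homology_dim ?D Fl i d"
  proof (rule homology_dim_connecting[where D = ?D and H = ?H, OF _ _ F])
    show "flinear ?D" by (rule flinear_restr[OF flinear_bd])
    show "flinear ?H" by (rule flinear_restr[OF flinear_cone])
    fix j and f :: "('v, 'p) cell \<Rightarrow> 'k" assume f: "f \<in> supp_on (level j F)"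
    show "?D f \<in> supp_on (level (j - 1) F)" by (rule bd_level[OF U(1) FU f])
    show "?H f \<in> supp_on (level (j + 1) F)" unfolding supp_on_def
    proof (intro CollectI allI impI, rule ccontr)
      fix x assume x: "x \<notin> level (j + 1) F" "?H f x \<noteq> 0"
      obtain A b where Ab: "x = (A, b)" by (cases x)
      have xF: "(A, b) \<in> F" and nz: "u \<in> A" "f (A - {u}, b) \<noteq> 0"
        using x(2) Ab by (auto simp: restr_def cone_def split: if_splits)
      have "(A - {u}, b) \<in> level j F" using f nz by (auto simp: supp_on_def)
      then have "int (card (A - {u})) = j" by (simp add: level_def)
      moreover have "finite A" using xF FU U finite_subset by blast
      then have "card A = Suc (card (A - {u}))" using nz(1) by (rule card.remove)
      ultimately have "int (card A) = j + 1" by linarith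
      then show False using x(1) xF Ab by (simp add: level_def)
    qed
  next
    fix f :: "('v, 'p) cell \<Rightarrow> 'k" assume f: "f \<in> supp_on F"
    show "?D f \<in> supp_on F" "?H f \<in> supp_on F" by simp_all
    show "?D (?D f) = 0" by (rule bd_restr_bd[OF U(1) FU conv f])
    show "?D (?H f) + ?H (?D f) = f"
    proof
      fix x :: "('v, 'p) cell"
      obtain B b where Bb: "x = (B, b)" by (cases x)
      show "(?D (?H f) + ?H (?D f)) x = f x"
      proof (cases "x \<in> F")
        case True
        have "(B - {u}, b) \<in> F" using cone True Bb by blast
        then have "(?D (?H f) + ?H (?D f)) x = bd U (cone u f) (B, b) + cone u (bd U f) (B, b)"
          using True Bb restr_id[OF coneF[OF f]] by (simp add: restr_def[of F "bd U _"] restr_def[of F "cone u (restr _ _)"] cone_def[of u "restr _ _"])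
            (simp add: restr_def cone_def)
        also have "\<dots> = f (B, b)"
          by (rule bd_cone) (use U True Bb FU in auto)
        finally show ?thesis using Bb by simp
      next
        case False
        then show ?thesis using f Bb by (simp add: restr_def supp_on_def)
      qed
    qed
  next
    fix f :: "('v, 'p) cell \<Rightarrow> 'k" assume f: "f \<in> supp_on Fl"
    show "?D f \<in> supp_on Fl" unfolding supp_on_def
    proof (intro CollectI allI impI, rule ccontr)
      fix x assume x: "x \<notin> Fl" "?D f x \<noteq> 0"
      obtain B b where Bb: "x = (B, b)" by (cases x)
      have xF: "(B, b) \<in> F" and nz: "bd U f (B, b) \<noteq> 0"
        using x(2) Bb by (auto simp: restr_def split: if_splits)
      obtain v where "(insert v B, b) \<in> Fl" using bd_supp_imp[OF f nz] by blast
      then show False using lower xF x(1) Bb by blast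
    qed
  next
    show "homology_dim ?D Fu (i + 1) d" using d F homology_dim_restr_cong[of Fu F] by blast
  qed
  then show ?thesis using F homology_dim_restr_cong[of Fl F] by blast
qed

lemma homology_dim_exists:
  assumes U: "finite U" and F: "finite F" "F \<subseteq> Pow U \<times> UNIV" "convex_cells F"
  shows "\<exists>d. homology_dim (bd U :: _ \<Rightarrow> _ \<Rightarrow> 'k::field) F i d"
  unfolding homology_dim_def
proof (rule quot_dim_exists)
  show "finite (level i F)" using F(1) level_subset finite_subset by metis
  show "cycles_on (bd U) F i \<subseteq> supp_on (level i F)" by (auto simp: cycles_on_def)
  show "fvec.subspace (cycles_on (bd U) F i)" "fvec.subspace (boundaries_on (bd U) F i)"
    by (intro subspace_cycles_on subspace_boundaries_on flinear_bd)+
  show "boundaries_on (bd U :: _ \<Rightarrow> _ \<Rightarrow> 'k) F i \<subseteq> cycles_on (bd U) F i"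
  proof
    fix y :: "('a, 'b) cell \<Rightarrow> 'k" assume "y \<in> boundaries_on (bd U) F i"
    then obtain w where w: "w \<in> supp_on (level (i + 1) F)" "y = restr F (bd U w)"
      by (auto simp: boundaries_on_def)
    show "y \<in> cycles_on (bd U) F i" unfolding cycles_on_def w(2)
      using bd_level[OF U F(2) w(1)] bd_restr_bd[OF U F(2,3) supp_on_mono[OF w(1) level_subset]] by simp
  qed
qed

section \<open>Duality of complementary families of cells\<close>

text \<open>The transpose of \<open>bd\<close>.\<close>

definition cobd :: "(('v::linorder, 'p) cell \<Rightarrow> 'k::field) \<Rightarrow> ('v, 'p) cell \<Rightarrow> 'k" where
  "cobd f = (\<lambda>(A, b). \<Sum>v\<in>A. ins_sign v (A - {v}) * f (A - {v}, b))"

lemma flinear_cobd: "flinear cobd"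
  by (rule flinearI) (auto simp: cobd_def fun_eq_iff algebra_simps sum.distrib sum_distrib_left)

lemma pairing_mono_neutral:
  assumes "finite G" "F \<subseteq> G" "g \<in> supp_on F \<or> f \<in> supp_on F"
  shows "pairing G f g = pairing F f g"
  unfolding pairing_def using assms by (intro sum.mono_neutral_right) (auto simp: supp_on_def)

lemma bd_adjoint:
  fixes f g :: "('v::linorder, 'p) cell \<Rightarrow> 'k::field"
  assumes U: "finite U" and F: "finite F" "F \<subseteq> Pow U \<times> UNIV"
    and f: "f \<in> supp_on F" and g: "g \<in> supp_on F"
  shows "pairing F (bd U f) g = pairing F f (cobd g)"
proof -
  \<comment> \<open>The family \<open>F\<close> need not be closed under adding or removing a vertex; the reindexing takes place in
    a box that is.\<close>
  define G where "G = Pow U \<times> snd ` F"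
  have G: "finite G" "F \<subseteq> G" using U F by (auto simp: G_def intro: rev_image_eqI)
  let ?t = "\<lambda>(B, b) v. ins_sign v B * f (insert v B, b) * g (B, b)"
  have "pairing F (bd U f) g = pairing G (bd U f) g"
    using pairing_mono_neutral[OF G] g by metis
  also have "\<dots> = (\<Sum>x\<in>G. \<Sum>v\<in>U - fst x. ?t x v)"
    by (simp add: pairing_def bd_def case_prod_unfold sum_distrib_right)
  also have "\<dots> = (\<Sum>(x, v)\<in>(SIGMA x:G. U - fst x). ?t x v)"
    using U G by (subst sum.Sigma) auto
  also have "\<dots> = (\<Sum>(x, v)\<in>(SIGMA x:G. fst x). f x * (ins_sign v (fst x - {v}) * g (fst x - {v}, snd x)))"
    by (rule sum.reindex_bij_witness[where
          i = "\<lambda>(x, v). ((fst x - {v}, snd x), v)" and j = "\<lambda>(x, v). ((insert v (fst x), snd x), v)"])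
      (auto simp: G_def insert_absorb mult_ac intro: rev_image_eqI)
  also have "\<dots> = (\<Sum>x\<in>G. \<Sum>v\<in>fst x. f x * (ins_sign v (fst x - {v}) * g (fst x - {v}, snd x)))"
    using U G by (subst sum.Sigma) (auto simp: G_def intro: finite_subset)
  also have "\<dots> = pairing G f (cobd g)"
    by (simp add: pairing_def cobd_def case_prod_unfold sum_distrib_left)
  also have "\<dots> = pairing F f (cobd g)"
    using pairing_mono_neutral[OF G] f by metis
  finally show ?thesis .
qed

lemma cobd_level:
  fixes f :: "('v::linorder, 'p) cell \<Rightarrow> 'k::field"
  assumes U: "finite U" and F: "F \<subseteq> Pow U \<times> UNIV" and f: "f \<in> supp_on (level i F)"
  shows "restr F (cobd f) \<in> supp_on (level (i + 1) F)"
  unfolding supp_on_def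
proof (intro CollectI allI impI, rule ccontr)
  fix x assume x: "x \<notin> level (i + 1) F" "restr F (cobd f) x \<noteq> 0"
  obtain A b where Ab: "x = (A, b)" by (cases x)
  have xF: "(A, b) \<in> F" and nz: "cobd f (A, b) \<noteq> 0"
    using x(2) Ab by (auto simp: restr_def split: if_splits)
  obtain v where v: "v \<in> A" "ins_sign v (A - {v}) * f (A - {v}, b) \<noteq> 0"
    using nz unfolding cobd_def prod.case by (meson sum.neutral)
  then have "f (A - {v}, b) \<noteq> 0" by auto
  then have "(A - {v}, b) \<in> level i F" using f by (auto simp: supp_on_def)
  then have "int (card (A - {v})) = i" by (simp add: level_def)
  moreover have "finite A" using xF F U finite_subset by blast
  then have "card A = Suc (card (A - {v}))" using v(1) by (rule card.remove)
  ultimately have "int (card A) = i + 1" by linarith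
  then show False using x(1) xF Ab by (simp add: level_def)
qed

lemma pairing_restr:
  assumes "finite F" "X \<subseteq> F" "g \<in> supp_on X"
  shows "pairing X (restr F h) g = pairing F h g" "pairing X g (restr F h) = pairing F g h"
proof -
  have "pairing F h g = pairing X h g" "pairing F g h = pairing X g h"
    using pairing_mono_neutral[OF assms(1,2)] assms(3) by metis+
  moreover have "pairing X (restr F h) g = pairing X h g" "pairing X g (restr F h) = pairing X g h"
    unfolding pairing_def restr_def using assms(2) by (auto intro!: sum.cong)
  ultimately show "pairing X (restr F h) g = pairing F h g" "pairing X g (restr F h) = pairing F g h" by simp_all
qed

lemma quot_dim_cobd:
  fixes F :: "('v::linorder, 'p) cell set"
  assumes U: "finite U" and F: "finite F" "F \<subseteq> Pow U \<times> UNIV" "convex_cells F"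
    and d: "homology_dim (bd U :: _ \<Rightarrow> _ \<Rightarrow> 'k::field) F i d"
  shows "quot_dim {g \<in> supp_on (level i F). restr F (cobd g :: _ \<Rightarrow> 'k) = 0}
           ((\<lambda>g. restr F (cobd g)) ` supp_on (level (i - 1) F)) d"
proof (rule quot_dim_transpose[where din = "\<lambda>f. restr F (bd U f)" and dout = "\<lambda>f. restr F (bd U f)"
      and W = "level (i + 1) F"])
  have sub: "level j F \<subseteq> F" for j by (rule level_subset)
  have fin: "finite (level j F)" for j using F(1) level_subset finite_subset by metis
  show "finite (level (i + 1) F)" "finite (level i F)" "finite (level (i - 1) F)" by (rule fin)+
  show "flinear (\<lambda>f. restr F (bd U f))" "flinear (\<lambda>f. restr F (bd U f))"
    by (rule flinear_restr[OF flinear_bd])+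
  show "restr F (bd U f) \<in> supp_on (level i F)" if "f \<in> supp_on (level (i + 1) F)" for f :: "('v, 'p) cell \<Rightarrow> 'k"
    using bd_level[OF U F(2) that] by simp
  show "restr F (bd U f) \<in> supp_on (level (i - 1) F)" if "f \<in> supp_on (level i F)" for f :: "('v, 'p) cell \<Rightarrow> 'k"
    using bd_level[OF U F(2) that] by simp
  show "restr F (cobd f) \<in> supp_on (level (i + 1) F)" if "f \<in> supp_on (level i F)" for f :: "('v, 'p) cell \<Rightarrow> 'k"
    using cobd_level[OF U F(2) that] by simp
  show "restr F (cobd f) \<in> supp_on (level i F)" if "f \<in> supp_on (level (i - 1) F)" for f :: "('v, 'p) cell \<Rightarrow> 'k"
    using cobd_level[OF U F(2) that] by simp
  have adj: "pairing (level k F) (restr F (bd U f)) g = pairing (level j F) f (restr F (cobd g))"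
    if "f \<in> supp_on (level j F)" "g \<in> supp_on (level k F)" for f g :: "('v, 'p) cell \<Rightarrow> 'k" and j k
    using bd_adjoint[OF U F(1,2) supp_on_mono[OF that(1) sub] supp_on_mono[OF that(2) sub]]
      pairing_restr(1)[OF F(1) sub that(2)] pairing_restr(2)[OF F(1) sub that(1)] by simp
  show "pairing (level i F) (restr F (bd U f)) g = pairing (level (i + 1) F) f (restr F (cobd g))"
    if "f \<in> supp_on (level (i + 1) F)" "g \<in> supp_on (level i F)" for f g :: "('v, 'p) cell \<Rightarrow> 'k"
    by (rule adj[OF that])
  show "pairing (level (i - 1) F) (restr F (bd U f)) g = pairing (level i F) f (restr F (cobd g))"
    if "f \<in> supp_on (level i F)" "g \<in> supp_on (level (i - 1) F)" for f g :: "('v, 'p) cell \<Rightarrow> 'k"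
    by (rule adj[OF that])
  show "restr F (bd U (restr F (bd U f))) = 0" if "f \<in> supp_on (level (i + 1) F)" for f :: "('v, 'p) cell \<Rightarrow> 'k"
    by (rule bd_restr_bd[OF U F(2,3) supp_on_mono[OF that sub]])
  show "quot_dim {f \<in> supp_on (level i F). restr F (bd U f :: _ \<Rightarrow> 'k) = 0}
     ((\<lambda>f. restr F (bd U f)) ` supp_on (level (i + 1) F)) d"
    using d by (simp add: homology_dim_def cycles_on_def boundaries_on_def)
qed

text \<open>A form of the Hodge star. The product of the \<open>ins_sign v U\<close> equals, up to a sign that depends only on
  the size of \<open>A\<close>, the sign of the shuffle of \<open>A\<close> and \<open>U - A\<close>, and it makes \<open>star\<close> exchange \<open>bd\<close> and
  \<open>cobd\<close> without further signs. Its inverse \<open>unstar\<close> differs in carrying the sign of the complement.\<close>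

definition star :: "'v::linorder set \<Rightarrow> ('p \<Rightarrow> 'p) \<Rightarrow> (('v, 'p) cell \<Rightarrow> 'k::field) \<Rightarrow> ('v, 'p) cell \<Rightarrow> 'k" where
  "star U \<iota> f = (\<lambda>(A, b). (\<Prod>v\<in>A. ins_sign v U) * f (U - A, \<iota> b))"

definition unstar :: "'v::linorder set \<Rightarrow> ('p \<Rightarrow> 'p) \<Rightarrow> (('v, 'p) cell \<Rightarrow> 'k::field) \<Rightarrow> ('v, 'p) cell \<Rightarrow> 'k" where
  "unstar U \<iota> f = (\<lambda>(A, b). (\<Prod>v\<in>U - A. ins_sign v U) * f (U - A, \<iota> b))"

lemma flinear_star: "flinear (star U \<iota>)" "flinear (unstar U \<iota>)"
  by (rule flinearI; auto simp: star_def unstar_def fun_eq_iff algebra_simps)+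

text \<open>The elements of \<open>U\<close> below \<open>v\<close> are split between \<open>B\<close> and its complement.\<close>

lemma ins_sign_complement:
  fixes U :: "'v::linorder set"
  assumes "finite U" "B \<subseteq> U" "v \<in> U - B"
  shows "ins_sign v B * ins_sign v U = (ins_sign v (U - insert v B) :: 'k::field)"
proof -
  have "{w \<in> U. w < v} = {w \<in> B. w < v} \<union> {w \<in> U - insert v B. w < v}" using assms by auto
  moreover have "finite B" using assms finite_subset by blast
  ultimately have "card {w \<in> U. w < v} = card {w \<in> B. w < v} + card {w \<in> U - insert v B. w < v}"
    using assms by (simp add: card_Un_disjoint disjoint_iff)
  then have "ins_sign v U = (ins_sign v B * ins_sign v (U - insert v B) :: 'k)"
    by (simp add: ins_sign_def power_add)
  then show ?thesis by simp
qed

lemma prod_ins_sign_square: "(\<Prod>v\<in>A. ins_sign v U) * ((\<Prod>v\<in>A. ins_sign v U) * x) = (x :: 'k::field)"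
  by (simp flip: mult.assoc prod.distrib)

text \<open>The map \<open>\<iota>\<close> is an involution only on the multidegrees that occur: in the application it truncates all
  coordinates from \<open>n\<close> on to \<open>0\<close>.\<close>

locale complementary_cells =
  fixes U :: "'v::linorder set" and \<iota> :: "'p \<Rightarrow> 'p" and F F' :: "('v, 'p) cell set"
  assumes finU: "finite U"
    and F: "(A, b) \<in> F \<Longrightarrow> A \<subseteq> U \<and> (U - A, \<iota> b) \<in> F' \<and> \<iota> (\<iota> b) = b"
    and F': "(A, b) \<in> F' \<Longrightarrow> A \<subseteq> U \<and> (U - A, \<iota> b) \<in> F \<and> \<iota> (\<iota> b) = b"
begin

lemma star_level:
  assumes "f \<in> supp_on (level i F)"
  shows "restr F' (star U \<iota> f) \<in> supp_on (level (int (card U) - i) F')"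
  unfolding supp_on_def
proof (intro CollectI allI impI, rule ccontr)
  fix x assume x: "x \<notin> level (int (card U) - i) F'" "restr F' (star U \<iota> f) x \<noteq> 0"
  obtain A b where Ab: "x = (A, b)" by (cases x)
  have xF: "(A, b) \<in> F'" and nz: "f (U - A, \<iota> b) \<noteq> 0"
    using x(2) Ab by (auto simp: restr_def star_def split: if_splits)
  have A: "A \<subseteq> U" "finite A" using F'[OF xF] finU finite_subset by auto
  have "(U - A, \<iota> b) \<in> level i F" using nz assms by (auto simp: supp_on_def)
  then have "int (card A) = int (card U) - i"
    using A finU card_mono[OF finU A(1)] by (simp add: level_def card_Diff_subset of_nat_diff)
  then show False using x xF Ab by (auto simp: level_def)
qed

lemma unstar_level:
  assumes "f \<in> supp_on (level i F')"
  shows "restr F (unstar U \<iota> f) \<in> supp_on (level (int (card U) - i) F)"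
  unfolding supp_on_def
proof (intro CollectI allI impI, rule ccontr)
  fix x assume x: "x \<notin> level (int (card U) - i) F" "restr F (unstar U \<iota> f) x \<noteq> 0"
  obtain A b where Ab: "x = (A, b)" by (cases x)
  have xF: "(A, b) \<in> F" and nz: "f (U - A, \<iota> b) \<noteq> 0"
    using x(2) Ab by (auto simp: restr_def unstar_def split: if_splits)
  have A: "A \<subseteq> U" "finite A" using F[OF xF] finU finite_subset by auto
  have "(U - A, \<iota> b) \<in> level i F'" using nz assms by (auto simp: supp_on_def)
  then have "int (card A) = int (card U) - i"
    using A finU card_mono[OF finU A(1)] by (simp add: level_def card_Diff_subset of_nat_diff)
  then show False using x xF Ab by (auto simp: level_def)
qed

lemma unstar_star:
  assumes "f \<in> supp_on F"
  shows "restr F (unstar U \<iota> (restr F' (star U \<iota> f))) = f"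
proof
  fix x :: "('v, 'p) cell"
  obtain A b where Ab: "x = (A, b)" by (cases x)
  show "restr F (unstar U \<iota> (restr F' (star U \<iota> f))) x = f x"
  proof (cases "x \<in> F")
    case True
    then have "A \<subseteq> U" "(U - A, \<iota> b) \<in> F'" "\<iota> (\<iota> b) = b" using F Ab by auto
    then show ?thesis using True Ab
      by (simp add: restr_def unstar_def star_def prod_ins_sign_square double_diff)
  qed (use assms Ab in \<open>auto simp: restr_def supp_on_def\<close>)
qed

lemma star_unstar:
  assumes "f \<in> supp_on F'"
  shows "restr F' (star U \<iota> (restr F (unstar U \<iota> f))) = f"
proof
  fix x :: "('v, 'p) cell"
  obtain A b where Ab: "x = (A, b)" by (cases x)
  show "restr F' (star U \<iota> (restr F (unstar U \<iota> f))) x = f x"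
  proof (cases "x \<in> F'")
    case True
    then have "A \<subseteq> U" "(U - A, \<iota> b) \<in> F" "\<iota> (\<iota> b) = b" using F' Ab by auto
    then show ?thesis using True Ab
      by (simp add: restr_def unstar_def star_def prod_ins_sign_square double_diff)
  qed (use assms Ab in \<open>auto simp: restr_def supp_on_def\<close>)
qed

lemma bd_star:
  assumes f: "f \<in> supp_on F"
  shows "restr F' (bd U (restr F' (star U \<iota> f))) = restr F' (star U \<iota> (restr F (cobd f)))"
proof
  fix x :: "('v, 'p) cell"
  obtain B b where Bb: "x = (B, b)" by (cases x)
  show "restr F' (bd U (restr F' (star U \<iota> f))) x = restr F' (star U \<iota> (restr F (cobd f))) x"
  proof (cases "x \<in> F'")
    case True
    then have B: "B \<subseteq> U" "(U - B, \<iota> b) \<in> F" "\<iota> (\<iota> b) = b" using F' Bb by auto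
    have finB: "finite B" using B finU finite_subset by auto
    have "bd U (restr F' (star U \<iota> f)) (B, b) =
        (\<Sum>v\<in>U - B. (\<Prod>w\<in>B. ins_sign w U) * (ins_sign v (U - insert v B) * f (U - insert v B, \<iota> b)))"
      unfolding bd_def prod.case
    proof (rule sum.cong[OF refl])
      fix v assume v: "v \<in> U - B"
      have "restr F' (star U \<iota> f) (insert v B, b) = star U \<iota> f (insert v B, b)"
      proof (cases "(insert v B, b) \<in> F'")
        case False
        \<comment> \<open>A vertex that leads out of one family leads out of the complementary one as well.\<close>
        have "(U - insert v B, \<iota> b) \<notin> F"
        proof
          assume "(U - insert v B, \<iota> b) \<in> F"
          then have "(U - (U - insert v B), \<iota> (\<iota> b)) \<in> F'" using F by blast
          then show False using False B v by (simp add: double_diff)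
        qed
        then show ?thesis using f False by (auto simp: restr_def star_def supp_on_def)
      qed (simp add: restr_def)
      then have "ins_sign v B * restr F' (star U \<iota> f) (insert v B, b)
          = ins_sign v B * ((\<Prod>w\<in>insert v B. ins_sign w U) * f (U - insert v B, \<iota> b))"
        by (simp add: star_def)
      also have "\<dots> = (\<Prod>w\<in>B. ins_sign w U) * ((ins_sign v B * ins_sign v U) * f (U - insert v B, \<iota> b))"
        using v finB by (simp add: mult_ac)
      finally show "ins_sign v B * restr F' (star U \<iota> f) (insert v B, b)
          = (\<Prod>w\<in>B. ins_sign w U) * (ins_sign v (U - insert v B) * f (U - insert v B, \<iota> b))"
        unfolding ins_sign_complement[OF finU B(1) v] .
    qed
    also have "\<dots> = star U \<iota> (restr F (cobd f)) (B, b)"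
      using B(2) by (simp add: star_def restr_def cobd_def sum_distrib_left Diff_insert[symmetric])
    finally show ?thesis using True Bb by (simp add: restr_def)
  qed (simp add: restr_def)
qed

lemma homology_dim_complement:
  assumes "finite F" "F \<subseteq> Pow U \<times> UNIV" "convex_cells F"
    and "homology_dim (bd U :: _ \<Rightarrow> _ \<Rightarrow> 'k::field) F i d"
  shows "homology_dim (bd U :: _ \<Rightarrow> _ \<Rightarrow> 'k::field) F' (int (card U) - i) d"
  unfolding homology_dim_def
proof (rule quot_dim_transfer)
  let ?s = "\<lambda>f :: _ \<Rightarrow> 'k. restr F' (star U \<iota> f)" and ?u = "\<lambda>f :: _ \<Rightarrow> 'k. restr F (unstar U \<iota> f)"
  let ?Z = "{g \<in> supp_on (level i F). restr F (cobd g :: _ \<Rightarrow> 'k) = 0}"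
  let ?B = "(\<lambda>g. restr F (cobd g :: _ \<Rightarrow> 'k)) ` supp_on (level (i - 1) F)"
  let ?N = "int (card U)"
  show lin: "flinear ?s" "flinear ?u" by (intro flinear_restr flinear_star)+
  show "fvec.subspace ?Z" by (intro subspace_kernel_on flinear_restr flinear_cobd subspace_supp_on)
  show "fvec.subspace ?B" by (intro subspace_image flinear_restr flinear_cobd subspace_supp_on)
  show "fvec.subspace (boundaries_on (bd U :: _ \<Rightarrow> _ \<Rightarrow> 'k) F' (?N - i))"
    by (rule subspace_boundaries_on[OF flinear_bd])
  show "quot_dim ?Z ?B d" by (rule quot_dim_cobd[OF finU assms])
  note mono = supp_on_mono[OF _ level_subset]
  have cobd_u: "restr F (cobd (?u h)) = ?u (restr F' (bd U h))" if h: "h \<in> supp_on F'" for h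
    using bd_star[of "?u h"] star_unstar[OF h] unstar_star[of "restr F (cobd (?u h))"] by simp
  show "?s z \<in> cycles_on (bd U) F' (?N - i)" if z: "z \<in> ?Z" for z
    using z star_level[of z i] bd_star[of z] mono flinear_simps(3)[OF lin(1)] by (auto simp: cycles_on_def)
  show "?u z \<in> ?Z" if "z \<in> cycles_on (bd U) F' (?N - i)" for z
    using that unstar_level[of z "?N - i"] cobd_u[of z] mono flinear_simps(3)[OF lin(2)] by (auto simp: cycles_on_def)
  show "?s y \<in> boundaries_on (bd U) F' (?N - i)" if y: "y \<in> ?B" for y
  proof -
    obtain w where w: "w \<in> supp_on (level (i - 1) F)" "y = restr F (cobd w)" using y by blast
    have "?s y = restr F' (bd U (?s w))" using bd_star[OF mono[OF w(1)]] w(2) by simp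
    moreover have "?s w \<in> supp_on (level (?N - i + 1) F')" using star_level[OF w(1)] by (simp add: algebra_simps)
    ultimately show ?thesis unfolding boundaries_on_def by blast
  qed
  show "?u y \<in> ?B" if y: "y \<in> boundaries_on (bd U) F' (?N - i)" for y
  proof -
    obtain w where w: "w \<in> supp_on (level (?N - i + 1) F')" "y = restr F' (bd U w)"
      using y by (auto simp: boundaries_on_def)
    have "?u y = restr F (cobd (?u w))" using cobd_u[OF mono[OF w(1)]] w(2) by simp
    moreover have "?u w \<in> supp_on (level (i - 1) F)" using unstar_level[OF w(1)] by (simp add: algebra_simps)
    ultimately show ?thesis by blast
  qed
  show "z - ?u (?s z) \<in> ?B" if "z \<in> ?Z" for z
  proof -
    have "?u (?s z) = z" using that mono unstar_star by blast
    then show ?thesis using fvec.subspace_0[OF \<open>fvec.subspace ?B\<close>] by simp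
  qed
  show "z - ?s (?u z) \<in> boundaries_on (bd U) F' (?N - i)" if "z \<in> cycles_on (bd U) F' (?N - i)" for z
  proof -
    have "z \<in> supp_on F'" using that mono by (auto simp: cycles_on_def)
    then show ?thesis
      using star_unstar[of z] fvec.subspace_0[OF \<open>fvec.subspace (boundaries_on (bd U) F' (?N - i))\<close>] by simp
  qed
qed

end

section \<open>Laurent monomials in mixed orthants\<close>

text \<open>The exponent vector of the product of the monomials in \<open>A\<close>.\<close>

definition total_exp :: "monomial set \<Rightarrow> nat \<Rightarrow> int" where
  "total_exp A x = (\<Sum>m\<in>A. int (Poly_Mapping.lookup m x))"

lemma total_exp_mono: "finite B \<Longrightarrow> A \<subseteq> B \<Longrightarrow> total_exp A x \<le> total_exp B x"
  unfolding total_exp_def by (rule sum_mono2) auto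

lemma total_exp_insert:
  "finite A \<Longrightarrow> m \<notin> A \<Longrightarrow> total_exp (insert m A) x = int (Poly_Mapping.lookup m x) + total_exp A x"
  by (simp add: total_exp_def)

lemma total_exp_Diff: "finite U \<Longrightarrow> A \<subseteq> U \<Longrightarrow> total_exp (U - A) x = total_exp U x - total_exp A x"
  by (simp add: total_exp_def sum_diff)

lemma total_exp_nonneg: "0 \<le> total_exp A x"
  by (simp add: total_exp_def sum_nonneg)

text \<open>The cell \<open>(A, b)\<close> stands for \<open>x\<^sup>a e\<^sub>A\<close> with \<open>a = b - total_exp A\<close>. So the condition says that \<open>a\<close> is
  negative in the first \<open>k\<close> coordinates and nonnegative in the others, and that the total degree is \<open>j\<close>:
  these cells index a basis of the degree \<open>j\<close> part of the Koszul complex with coefficients in \<open>M\<^sub>k\<close>.\<close>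

definition orthant_cells :: "monomial set \<Rightarrow> nat \<Rightarrow> nat \<Rightarrow> int \<Rightarrow> (monomial, nat \<Rightarrow> int) cell set" where
  "orthant_cells U n k j = {(A, b). A \<subseteq> U \<and>
     (\<forall>x<n. if x < k then b x < total_exp A x else total_exp A x \<le> b x) \<and>
     (\<forall>x\<ge>n. b x = 0) \<and> (\<Sum>x<n. b x) = j}"

text \<open>Without the condition on the coordinate \<open>k\<close> the family is a cone with apex \<open>u\<close>, since adding or removing
  \<open>u\<close> changes only that coordinate of \<open>a\<close>. The cells where it is nonnegative are closed under passing to
  subsets of \<open>A\<close>, because removing a monomial from \<open>A\<close> does not decrease \<open>a\<close>.\<close>

lemma homology_dim_orthant_step:
  assumes U: "finite U" and k: "k < n" and u: "u \<in> U" "\<And>x. x \<noteq> k \<Longrightarrow> Poly_Mapping.lookup u x = 0"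
    and d: "homology_dim (bd U :: _ \<Rightarrow> _ \<Rightarrow> 'k::field) (orthant_cells U n (Suc k) j) (i + 1) d"
  shows "homology_dim (bd U :: _ \<Rightarrow> _ \<Rightarrow> 'k::field) (orthant_cells U n k j) i d"
proof -
  define F where "F = {(A, b). A \<subseteq> U \<and>
     (\<forall>x<n. x \<noteq> k \<longrightarrow> (if x < k then b x < total_exp A x else total_exp A x \<le> b x)) \<and>
     (\<forall>x\<ge>n. b x = 0) \<and> (\<Sum>x<n. b x) = j}"
  have fin: "finite A" if "A \<subseteq> U" for A using that U finite_subset by blast
  show ?thesis
  proof (rule homology_dim_cone_step[where F = F and Fu = "orthant_cells U n (Suc k) j" and u = u])
    show "F \<subseteq> Pow U \<times> UNIV" by (auto simp: F_def)
    show "convex_cells F" unfolding convex_cells_def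
    proof (intro allI impI)
      fix A B C b assume AC: "(A, b) \<in> F" "(C, b) \<in> F" "A \<subseteq> B" "B \<subseteq> C"
      then have "C \<subseteq> U" "B \<subseteq> U" by (auto simp: F_def)
      then have "total_exp A x \<le> total_exp B x" "total_exp B x \<le> total_exp C x" for x
        using AC fin total_exp_mono by metis+
      then show "(B, b) \<in> F" using AC \<open>B \<subseteq> U\<close> unfolding F_def
        by (auto split: if_splits) (meson order_less_le_trans order_trans)+
    qed
    show "orthant_cells U n k j \<union> orthant_cells U n (Suc k) j = F"
    proof (rule Set.set_eqI)
      fix y :: "(monomial, nat \<Rightarrow> int) cell"
      obtain A b where y: "y = (A, b)" by (cases y)
      have "(\<forall>x<n. if x < k then b x < total_exp A x else total_exp A x \<le> b x) \<longleftrightarrow>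
        (\<forall>x<n. x \<noteq> k \<longrightarrow> (if x < k then b x < total_exp A x else total_exp A x \<le> b x)) \<and> total_exp A k \<le> b k"
        using k by (metis less_irrefl)
      moreover have "(\<forall>x<n. if x < Suc k then b x < total_exp A x else total_exp A x \<le> b x) \<longleftrightarrow>
        (\<forall>x<n. x \<noteq> k \<longrightarrow> (if x < k then b x < total_exp A x else total_exp A x \<le> b x)) \<and> b k < total_exp A k"
        using k by (metis less_Suc_eq)
      ultimately show "y \<in> orthant_cells U n k j \<union> orthant_cells U n (Suc k) j \<longleftrightarrow> y \<in> F"
        unfolding y orthant_cells_def F_def by auto
    qed
    show "orthant_cells U n k j \<inter> orthant_cells U n (Suc k) j = {}"
      using k by (fastforce simp: orthant_cells_def)
    fix A :: "monomial set" and b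
    have same: "total_exp (insert u A) x = total_exp A x" "total_exp (A - {u}) x = total_exp A x"
      if "A \<subseteq> U" "x \<noteq> k" for x
    proof -
      show "total_exp (insert u A) x = total_exp A x"
        using total_exp_insert[OF fin[OF that(1)], of u x] u(2)[OF that(2)] by (cases "u \<in> A") (auto simp: insert_absorb)
      show "total_exp (A - {u}) x = total_exp A x"
        using total_exp_insert[of "A - {u}" u x] fin[OF that(1)] u(2)[OF that(2)] by (cases "u \<in> A") (auto simp: insert_absorb)
    qed
    show "(insert u A, b) \<in> F \<and> (A - {u}, b) \<in> F" if "(A, b) \<in> F"
      using that u(1) same unfolding F_def by auto
    show "(B, b) \<in> orthant_cells U n k j"
      if AB: "(A, b) \<in> orthant_cells U n k j" "(B, b) \<in> F" "B \<subseteq> A" for B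
    proof -
      have "A \<subseteq> U" using AB by (auto simp: orthant_cells_def)
      then have "total_exp B k \<le> total_exp A k" using AB fin total_exp_mono by metis
      also have "\<dots> \<le> b k" using AB(1) k by (force simp: orthant_cells_def)
      finally show ?thesis using AB(2) unfolding F_def orthant_cells_def
        by auto
    qed
  qed (use U u d in auto)
qed

text \<open>The connecting isomorphisms, composed from the last variable down to the first.\<close>

lemma homology_dim_orthant_shift:
  assumes U: "finite U" and u: "\<And>k. k < n \<Longrightarrow> \<exists>u\<in>U. \<forall>x. x \<noteq> k \<longrightarrow> Poly_Mapping.lookup u x = 0"
    and d: "homology_dim (bd U :: _ \<Rightarrow> _ \<Rightarrow> 'k::field) (orthant_cells U n n j) (i + int n) d"
  shows "homology_dim (bd U :: _ \<Rightarrow> _ \<Rightarrow> 'k::field) (orthant_cells U n 0 j) i d"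
proof -
  have "m \<le> n \<Longrightarrow> homology_dim (bd U :: _ \<Rightarrow> _ \<Rightarrow> 'k) (orthant_cells U n (n - m) j) (i + int (n - m)) d" for m
  proof (induction m)
    case 0 then show ?case using d by simp
  next
    case (Suc m)
    define k where "k = n - Suc m"
    have k: "k < n" "n - m = Suc k" using Suc.prems by (auto simp: k_def)
    obtain v where v: "v \<in> U" "\<And>x. x \<noteq> k \<Longrightarrow> Poly_Mapping.lookup v x = 0" using u[OF k(1)] by blast
    have "homology_dim (bd U :: _ \<Rightarrow> _ \<Rightarrow> 'k) (orthant_cells U n (Suc k) j) (i + int k + 1) d"
      using Suc by (simp add: k(2) add_ac)
    then show ?case unfolding k_def[symmetric] using homology_dim_orthant_step[OF U k(1) v] by blast
  qed
  from this[of n] show ?thesis by simp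
qed

lemma finite_orthant_cells:
  assumes "finite U" shows "finite (orthant_cells U n 0 j)"
proof (rule finite_subset)
  show "orthant_cells U n 0 j \<subseteq> Pow U \<times> {b. \<forall>x. (x \<in> {..<n} \<longrightarrow> b x \<in> {0..j}) \<and> (x \<notin> {..<n} \<longrightarrow> b x = 0)}"
  proof
    fix y assume "y \<in> orthant_cells U n 0 j"
    then obtain A b where y: "y = (A, b)" "A \<subseteq> U" "\<And>x. x < n \<Longrightarrow> total_exp A x \<le> b x"
      "\<And>x. x \<ge> n \<Longrightarrow> b x = 0" "(\<Sum>x<n. b x) = j" by (auto simp: orthant_cells_def)
    have nn: "0 \<le> b x" if "x < n" for x using y(3)[OF that] total_exp_nonneg order_trans by blast
    have "b x \<le> j" if "x < n" for x unfolding y(5)[symmetric]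
      by (rule member_le_sum) (use that nn in auto)
    then show "y \<in> Pow U \<times> {b. \<forall>x. (x \<in> {..<n} \<longrightarrow> b x \<in> {0..j}) \<and> (x \<notin> {..<n} \<longrightarrow> b x = 0)}"
      using y nn by auto
  qed
  show "finite (Pow U \<times> {b. \<forall>x. (x \<in> {..<n} \<longrightarrow> b x \<in> {0..j}) \<and> (x \<notin> {..<n} \<longrightarrow> b x = 0)})"
    using assms by (intro finite_cartesian_product finite_set_of_finite_funs) auto
qed

lemma convex_orthant_cells:
  assumes "finite U" shows "convex_cells (orthant_cells U n k j)"
  unfolding convex_cells_def
proof (intro allI impI)
  fix A B C b assume AC: "(A, b) \<in> orthant_cells U n k j" "(C, b) \<in> orthant_cells U n k j" "A \<subseteq> B" "B \<subseteq> C"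
  then have "C \<subseteq> U" "B \<subseteq> U" by (auto simp: orthant_cells_def)
  then have "total_exp A x \<le> total_exp B x" "total_exp B x \<le> total_exp C x" for x
    using AC assms total_exp_mono finite_subset by metis+
  then show "(B, b) \<in> orthant_cells U n k j" using AC \<open>B \<subseteq> U\<close> unfolding orthant_cells_def
    by (auto split: if_splits) (meson order_less_le_trans order_trans)+
qed

text \<open>The multidegrees correspond by \<open>b \<mapsto> total_exp U - 1 - b\<close> in the first \<open>n\<close> coordinates, which sends
  the exponents \<open>b - total_exp A\<close> to \<open>-1\<close> minus themselves when \<open>A\<close> is replaced by \<open>U - A\<close>. Hence
  the orthant of nonnegative exponents is complementary to the one of negative exponents; the connecting
  isomorphisms lead back from there.\<close>

lemma homology_dim_orthant_duality:
  assumes U: "finite U" and u: "\<And>k. k < n \<Longrightarrow> \<exists>u\<in>U. \<forall>x. x \<noteq> k \<longrightarrow> Poly_Mapping.lookup u x = 0"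
    and d: "homology_dim (bd U :: _ \<Rightarrow> _ \<Rightarrow> 'k::field) (orthant_cells U n 0 j) i d"
  shows "homology_dim (bd U :: _ \<Rightarrow> _ \<Rightarrow> 'k::field)
    (orthant_cells U n 0 ((\<Sum>x<n. total_exp U x) - int n - j)) (int (card U) - int n - i) d"
proof (rule homology_dim_orthant_shift[OF U u])
  let ?\<iota> = "\<lambda>b x. if x < n then total_exp U x - 1 - b x else (0::int)"
  let ?j = "(\<Sum>x<n. total_exp U x) - int n - j"
  have sum: "(\<Sum>x<n. ?\<iota> b x) = (\<Sum>x<n. total_exp U x) - int n - (\<Sum>x<n. b x)" for b
    by (simp add: sum_subtractf)
  have inv: "?\<iota> (?\<iota> b) = b" if "\<forall>x\<ge>n. b x = 0" for b using that by (auto simp: fun_eq_iff)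
  interpret complementary_cells U ?\<iota> "orthant_cells U n 0 j" "orthant_cells U n n ?j"
  proof
    show "finite U" by fact
    show "A \<subseteq> U \<and> (U - A, ?\<iota> b) \<in> orthant_cells U n n ?j \<and> ?\<iota> (?\<iota> b) = b"
      if "(A, b) \<in> orthant_cells U n 0 j" for A b
      using that sum[of b] inv[of b] by (auto simp: orthant_cells_def total_exp_Diff[OF U])
    show "A \<subseteq> U \<and> (U - A, ?\<iota> b) \<in> orthant_cells U n 0 j \<and> ?\<iota> (?\<iota> b) = b"
      if "(A, b) \<in> orthant_cells U n n ?j" for A b
      using that sum[of b] inv[of b] by (auto simp: orthant_cells_def total_exp_Diff[OF U])
  qed
  have "homology_dim (bd U :: _ \<Rightarrow> _ \<Rightarrow> 'k) (orthant_cells U n n ?j) (int (card U) - i) d"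
    by (rule homology_dim_complement[OF finite_orthant_cells[OF U] _ convex_orthant_cells[OF U] d])
      (auto simp: orthant_cells_def)
  then show "homology_dim (bd U :: _ \<Rightarrow> _ \<Rightarrow> 'k) (orthant_cells U n n ?j) (int (card U) - int n - i + int n) d"
    by (simp add: algebra_simps)
qed

section \<open>Monomials\<close>

lemma keys_subset_iff: "Poly_Mapping.keys p \<subseteq> S \<longleftrightarrow> (\<forall>m. Poly_Mapping.lookup p m \<noteq> 0 \<longrightarrow> m \<in> S)"
  by (auto simp: in_keys_iff)

lemma sum_single_lookup: "(\<Sum>s\<in>Poly_Mapping.keys q. Poly_Mapping.single s (Poly_Mapping.lookup q s)) = q"
  by (rule poly_mapping_eqI) (auto simp: lookup_sum lookup_single when_def in_keys_iff sum.delta)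

lemma lookup_monomial_mult:
  fixes q :: "'k::field mpoly"
  shows "Poly_Mapping.lookup (Poly_Mapping.single m a * q) t =
    (if \<forall>x. Poly_Mapping.lookup m x \<le> Poly_Mapping.lookup t x then a * Poly_Mapping.lookup q (t - m) else 0)"
proof -
  have le: "(\<forall>x. Poly_Mapping.lookup m x \<le> Poly_Mapping.lookup t x) \<longleftrightarrow> m + (t - m) = t"
    by (auto simp: poly_mapping_eq_iff fun_eq_iff lookup_add lookup_minus) (metis le_add1)
  have "Poly_Mapping.lookup (Poly_Mapping.single m a * q) t =
     Poly_Mapping.lookup (Poly_Mapping.single m a * (\<Sum>s\<in>Poly_Mapping.keys q. Poly_Mapping.single s (Poly_Mapping.lookup q s))) t"
    by (simp add: sum_single_lookup)
  also have "\<dots> = (\<Sum>s\<in>Poly_Mapping.keys q. if m + s = t then a * Poly_Mapping.lookup q s else 0)"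
    by (simp add: sum_distrib_left mult_single lookup_sum lookup_single when_def)
  also have "\<dots> = (if m + (t - m) = t then a * Poly_Mapping.lookup q (t - m) else 0)"
  proof (cases "m + (t - m) = t")
    case True
    then have "m + s = t \<longleftrightarrow> s = t - m" for s by (metis add_diff_cancel_left')
    then show ?thesis using True by (simp add: in_keys_iff)
  next
    case False
    then have "m + s \<noteq> t" for s by (metis add_diff_cancel_left')
    then show ?thesis using False by simp
  qed
  finally show ?thesis by (simp only: le)
qed

lemma lookup_const_mult:
  fixes q :: "'k::field mpoly"
  shows "Poly_Mapping.lookup (Poly_Mapping.single 0 a * q) t = a * Poly_Mapping.lookup q t"
  by (simp add: lookup_monomial_mult)

lemma lookup_sign_mult:
  fixes q :: "'k::field mpoly"
  shows "Poly_Mapping.lookup ((-1) ^ k * q) t = (-1) ^ k * Poly_Mapping.lookup q t"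
  by (cases "even k") simp_all

definition mon_of :: "nat \<Rightarrow> (nat \<Rightarrow> int) \<Rightarrow> monomial" where
  "mon_of n f = Abs_poly_mapping (\<lambda>x. if x < n then nat (f x) else 0)"

lemma lookup_mon_of: "Poly_Mapping.lookup (mon_of n f) x = (if x < n then nat (f x) else 0)"
proof -
  have "finite {x. (if x < n then nat (f x) else 0) \<noteq> 0}"
    by (rule finite_subset[of _ "{..<n}"]) auto
  then show ?thesis by (simp add: mon_of_def)
qed

lemma mon_of_in_monomials: "mon_of n f \<in> monomials n"
  by (auto simp: monomials_def in_keys_iff lookup_mon_of split: if_splits)

lemma mon_deg_eq: "m \<in> monomials n \<Longrightarrow> mon_deg m = (\<Sum>x<n. Poly_Mapping.lookup m x)"
  unfolding mon_deg_def monomials_def by (intro sum.mono_neutral_left) (auto simp: in_keys_iff)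

lemma monomials_lookup_zero: "m \<in> monomials n \<Longrightarrow> x \<ge> n \<Longrightarrow> Poly_Mapping.lookup m x = 0"
  by (auto simp: monomials_def in_keys_iff)

lemma sum_total_exp:
  assumes "A \<subseteq> monomials_of_deg n c"
  shows "(\<Sum>x<n. total_exp A x) = int (card A * c)"
proof -
  have "(\<Sum>x<n. total_exp A x) = (\<Sum>m\<in>A. \<Sum>x<n. int (Poly_Mapping.lookup m x))"
    unfolding total_exp_def by (rule sum.swap)
  also have "\<dots> = (\<Sum>m\<in>A. int c)"
    by (rule sum.cong) (use assms in \<open>auto simp: monomials_of_deg_def mon_deg_eq\<close>)
  finally show ?thesis by simp
qed

lemma bij_betw_monomials_of_deg:
  "bij_betw (\<lambda>m. map (Poly_Mapping.lookup m) [0..<n]) (monomials_of_deg n c) {l. length l = n \<and> sum_list l = c}"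
proof (rule bij_betwI')
  fix m m' assume m: "m \<in> monomials_of_deg n c" "m' \<in> monomials_of_deg n c"
  show "(map (Poly_Mapping.lookup m) [0..<n] = map (Poly_Mapping.lookup m') [0..<n]) = (m = m')"
  proof
    assume eq: "map (Poly_Mapping.lookup m) [0..<n] = map (Poly_Mapping.lookup m') [0..<n]"
    show "m = m'"
    proof (rule poly_mapping_eqI)
      fix x show "Poly_Mapping.lookup m x = Poly_Mapping.lookup m' x"
        using eq m monomials_lookup_zero[of _ n x] by (cases "x < n") (auto simp: monomials_of_deg_def)
    qed
  qed simp
next
  fix m assume m: "m \<in> monomials_of_deg n c"
  then have "c = (\<Sum>x<n. Poly_Mapping.lookup m x)" using mon_deg_eq[of m n] by (simp add: monomials_of_deg_def)
  then show "map (Poly_Mapping.lookup m) [0..<n] \<in> {l. length l = n \<and> sum_list l = c}"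
    by (simp add: interv_sum_list_conv_sum_set_nat atLeast0LessThan)
next
  fix l :: "nat list" assume l: "l \<in> {l. length l = n \<and> sum_list l = c}"
  let ?m = "mon_of n (\<lambda>x. int (l ! x))"
  have "map (Poly_Mapping.lookup ?m) [0..<n] = l"
    by (rule nth_equalityI) (use l in \<open>auto simp: lookup_mon_of\<close>)
  moreover have "mon_deg ?m = c"
    using l by (auto simp: mon_deg_eq[OF mon_of_in_monomials] lookup_mon_of sum_list_sum_nth atLeast0LessThan)
  ultimately show "\<exists>m\<in>monomials_of_deg n c. l = map (Poly_Mapping.lookup m) [0..<n]"
    using mon_of_in_monomials[of n "\<lambda>x. int (l ! x)"]
    by (intro bexI[of _ ?m]) (auto simp: monomials_of_deg_def)
qed

lemma finite_monomials_of_deg: "finite (monomials_of_deg n c)"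
proof -
  have "finite {l :: nat list. length l = n \<and> sum_list l = c}"
    by (rule finite_subset[OF _ finite_lists_length_eq[of "{..c}" n]]) (auto simp: member_le_sum_list)
  then show ?thesis using bij_betw_finite[OF bij_betw_monomials_of_deg] by blast
qed

lemma card_monomials_of_deg: "card (monomials_of_deg n c) = (n + c - 1) choose c"
  using bij_betw_same_card[OF bij_betw_monomials_of_deg[of n c]] card_length_sum_list[of n c]
  by (simp add: add.commute)

text \<open>The powers of the variables are the apexes of the cones.\<close>

lemma pure_power_in_monomials_of_deg:
  assumes "k < n"
  shows "\<exists>u\<in>monomials_of_deg n c. \<forall>x. x \<noteq> k \<longrightarrow> Poly_Mapping.lookup u x = 0"
proof (rule bexI)
  let ?u = "mon_of n (\<lambda>x. if x = k then int c else 0)"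
  show "\<forall>x. x \<noteq> k \<longrightarrow> Poly_Mapping.lookup ?u x = 0" by (simp add: lookup_mon_of)
  have "mon_deg ?u = (\<Sum>x<n. if x = k then c else 0)"
    unfolding mon_deg_eq[OF mon_of_in_monomials] by (intro sum.cong) (auto simp: lookup_mon_of)
  also have "\<dots> = c" using assms by simp
  finally show "?u \<in> monomials_of_deg n c" by (simp add: monomials_of_deg_def mon_of_in_monomials)
qed

section \<open>The graded Koszul complex in terms of cells\<close>

text \<open>The coefficient of \<open>x\<^sup>m e\<^sub>A\<close>. An element of the Koszul complex is determined by these scalars, so all
  identities below are checked on them.\<close>

definition kcoeff :: "'k::field koszul \<Rightarrow> monomial set \<Rightarrow> monomial \<Rightarrow> 'k" where
  "kcoeff u A m = Poly_Mapping.lookup (Poly_Mapping.lookup u A) m"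

lemma koszul_eqI: "(\<And>A m. kcoeff u A m = kcoeff v A m) \<Longrightarrow> u = v"
  unfolding kcoeff_def by (intro poly_mapping_eqI)

definition kscale :: "'k::field \<Rightarrow> 'k koszul \<Rightarrow> 'k koszul" where
  "kscale a = Poly_Mapping.map (\<lambda>q. Poly_Mapping.single 0 a * q)"

lemma kcoeff_simps [simp]:
  "kcoeff (u + v) A m = kcoeff u A m + kcoeff v A m"
  "kcoeff (u - v) A m = kcoeff u A m - kcoeff v A m"
  "kcoeff 0 A m = 0"
  "kcoeff (kscale a u) A m = a * kcoeff u A m"
  "kcoeff (\<Sum>i\<in>I. w i) A m = (\<Sum>i\<in>I. kcoeff (w i) A m)"
  by (auto simp: kcoeff_def kscale_def lookup_add lookup_minus map.rep_eq when_def lookup_const_mult lookup_sum)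

interpretation kvec: vector_space kscale
  by unfold_locales (auto intro!: koszul_eqI simp: algebra_simps)

lemma koszul_module_carrier_iff:
  "u \<in> carrier (koszul_module n c t) \<longleftrightarrow>
    (\<forall>A m. kcoeff u A m \<noteq> 0 \<longrightarrow> A \<subseteq> monomials_of_deg n c \<and> int (card A) = t \<and> m \<in> monomials n)"
proof -
  have "(\<exists>m. kcoeff u A m \<noteq> 0) \<longleftrightarrow> A \<in> Poly_Mapping.keys u" for A
    unfolding kcoeff_def in_keys_iff by (metis lookup_zero poly_mapping_eqI)
  then show ?thesis
    by (auto simp: koszul_module_def poly_ring_def keys_subset_iff kcoeff_def)
qed

lemma koszul_homogeneous_iff:
  "u \<in> koszul_homogeneous c j \<longleftrightarrow> (\<forall>A m. kcoeff u A m \<noteq> 0 \<longrightarrow> int (mon_deg m) + int (card A * c) = j)"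
proof -
  have "A \<in> Poly_Mapping.keys u" if "kcoeff u A m \<noteq> 0" for A m
    using that unfolding kcoeff_def in_keys_iff by auto
  then show ?thesis by (auto simp: koszul_homogeneous_def kcoeff_def in_keys_iff)
qed

lemma kcoeff_nonzero_add: "kcoeff (u + v) A m \<noteq> 0 \<Longrightarrow> kcoeff u A m \<noteq> 0 \<or> kcoeff v A m \<noteq> 0"
  by auto

lemma koszul_module_closed:
  fixes u v :: "'k::field koszul"
  shows "0 \<in> carrier (koszul_module n c t)"
  and "u \<in> carrier (koszul_module n c t) \<Longrightarrow> v \<in> carrier (koszul_module n c t) \<Longrightarrow> u + v \<in> carrier (koszul_module n c t)"
  and "u \<in> carrier (koszul_module n c t) \<Longrightarrow> kscale a u \<in> carrier (koszul_module n c t)"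
proof -
  show "0 \<in> carrier (koszul_module n c t)" by (simp add: koszul_module_carrier_iff)
  show "u + v \<in> carrier (koszul_module n c t)" if "u \<in> carrier (koszul_module n c t)" "v \<in> carrier (koszul_module n c t)"
    unfolding koszul_module_carrier_iff
  proof (intro allI impI)
    fix A m assume "kcoeff (u + v) A m \<noteq> 0"
    then consider "kcoeff u A m \<noteq> 0" | "kcoeff v A m \<noteq> 0" using kcoeff_nonzero_add by blast
    then show "A \<subseteq> monomials_of_deg n c \<and> int (card A) = t \<and> m \<in> monomials n"
      using that unfolding koszul_module_carrier_iff by cases simp_all
  qed
  show "kscale a u \<in> carrier (koszul_module n c t)" if "u \<in> carrier (koszul_module n c t)"
    using that unfolding koszul_module_carrier_iff by simp blast
qed

lemma koszul_homogeneous_closed: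
  fixes u v :: "'k::field koszul"
  shows "0 \<in> koszul_homogeneous c j"
  and "u \<in> koszul_homogeneous c j \<Longrightarrow> v \<in> koszul_homogeneous c j \<Longrightarrow> u + v \<in> koszul_homogeneous c j"
  and "u \<in> koszul_homogeneous c j \<Longrightarrow> kscale a u \<in> koszul_homogeneous c j"
proof -
  show "0 \<in> koszul_homogeneous c j" by (simp add: koszul_homogeneous_iff)
  show "u + v \<in> koszul_homogeneous c j" if "u \<in> koszul_homogeneous c j" "v \<in> koszul_homogeneous c j"
    unfolding koszul_homogeneous_iff
  proof (intro allI impI)
    fix A m assume "kcoeff (u + v) A m \<noteq> 0"
    then consider "kcoeff u A m \<noteq> 0" | "kcoeff v A m \<noteq> 0" using kcoeff_nonzero_add by blast
    then show "int (mon_deg m) + int (card A * c) = j"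
      using that unfolding koszul_homogeneous_iff by cases simp_all
  qed
  show "kscale a u \<in> koszul_homogeneous c j" if "u \<in> koszul_homogeneous c j"
    using that by (auto simp: koszul_homogeneous_iff)
qed

text \<open>The coefficient of \<open>e\<^sub>B\<close> receives one contribution from each \<open>A\<close> that arises from \<open>B\<close> by adding a
  monomial \<open>m\<close>. Removing \<open>m\<close> from \<open>A\<close> does not change the number of smaller elements, so the sign can
  be read off from \<open>B\<close>.\<close>

lemma lookup_koszul_diff:
  assumes u: "u \<in> carrier (koszul_module n c t)"
  shows "Poly_Mapping.lookup (koszul_diff u) B = (\<Sum>m\<in>monomials_of_deg n c - B.
    (-1) ^ card {m' \<in> B. m' < m} * Poly_Mapping.single m 1 * Poly_Mapping.lookup u (insert m B))"
proof -
  let ?U = "monomials_of_deg n c"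
  have KU: "A \<subseteq> ?U" if "A \<in> Poly_Mapping.keys u" for A using u that by (auto simp: koszul_module_def)
  have finK: "finite A" if "A \<in> Poly_Mapping.keys u" for A
    using finite_subset[OF KU[OF that] finite_monomials_of_deg] .
  let ?g = "\<lambda>A m. (-1) ^ card {m' \<in> A. m' < m} * Poly_Mapping.single m 1 * Poly_Mapping.lookup u A"
  let ?P = "SIGMA A:Poly_Mapping.keys u. A"
  have "Poly_Mapping.lookup (koszul_diff u) B =
      (\<Sum>A\<in>Poly_Mapping.keys u. \<Sum>m\<in>A. if A - {m} = B then ?g A m else 0)"
    by (simp add: koszul_diff_def lookup_sum lookup_single when_def)
  also have "\<dots> = (\<Sum>(A, m)\<in>?P. if A - {m} = B then ?g A m else 0)"
    by (rule sum.Sigma) (use finK in auto)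
  also have "\<dots> = (\<Sum>(A, m)\<in>{(A, m)\<in>?P. A - {m} = B}. ?g A m)"
    by (rule sum.mono_neutral_cong_right) (use finK in \<open>auto split: if_splits\<close>)
  also have "\<dots> = (\<Sum>m\<in>{m\<in>?U - B. insert m B \<in> Poly_Mapping.keys u}.
      (-1) ^ card {m' \<in> B. m' < m} * Poly_Mapping.single m 1 * Poly_Mapping.lookup u (insert m B))"
  proof (rule sum.reindex_bij_witness[where i = "\<lambda>m. (insert m B, m)" and j = snd])
    fix p assume p: "p \<in> {(A, m)\<in>?P. A - {m} = B}"
    obtain A m where pm: "p = (A, m)" by (cases p)
    then have A: "A \<in> Poly_Mapping.keys u" "m \<in> A" "A - {m} = B" using p by auto
    then have ins: "insert m B = A" "m \<notin> B" by auto
    have "{m' \<in> A. m' < m} = {m' \<in> B. m' < m}" unfolding ins(1)[symmetric] by auto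
    then show "(-1) ^ card {m' \<in> B. m' < snd p} * Poly_Mapping.single (snd p) 1 * Poly_Mapping.lookup u (insert (snd p) B)
       = (case p of (A, m) \<Rightarrow> ?g A m)" using ins by (simp add: pm)
    show "(insert (snd p) B, snd p) = p" using pm ins by simp
    show "snd p \<in> {m\<in>?U - B. insert m B \<in> Poly_Mapping.keys u}" using pm ins A KU by auto
  qed auto
  also have "\<dots> = (\<Sum>m\<in>?U - B.
      (-1) ^ card {m' \<in> B. m' < m} * Poly_Mapping.single m 1 * Poly_Mapping.lookup u (insert m B))"
    by (rule sum.mono_neutral_left) (auto simp: finite_monomials_of_deg in_keys_iff)
  finally show ?thesis .
qed

lemma kcoeff_koszul_diff:
  assumes u: "u \<in> carrier (koszul_module n c t)"
  shows "kcoeff (koszul_diff u) B s = (\<Sum>m\<in>monomials_of_deg n c - B.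
    ins_sign m B * (if \<forall>x. Poly_Mapping.lookup m x \<le> Poly_Mapping.lookup s x then kcoeff u (insert m B) (s - m) else 0))"
  by (simp add: kcoeff_def lookup_koszul_diff[OF u] lookup_sum mult.assoc lookup_sign_mult lookup_monomial_mult ins_sign_def
      cong: if_cong)

lemma koszul_diff_linear:
  assumes "u \<in> carrier (koszul_module n c t)" "v \<in> carrier (koszul_module n c t)"
  shows "koszul_diff (u + v) = koszul_diff u + koszul_diff v"
    "koszul_diff (kscale a u) = kscale a (koszul_diff u)"
proof -
  show "koszul_diff (u + v) = koszul_diff u + koszul_diff v"
  proof (rule koszul_eqI)
    fix B s
    show "kcoeff (koszul_diff (u + v)) B s = kcoeff (koszul_diff u + koszul_diff v) B s"
      unfolding kcoeff_simps kcoeff_koszul_diff[OF assms(1)] kcoeff_koszul_diff[OF assms(2)]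
        kcoeff_koszul_diff[OF koszul_module_closed(2)[OF assms]] sum.distrib[symmetric]
      by (rule sum.cong) (simp_all add: distrib_left)
  qed
  show "koszul_diff (kscale a u) = kscale a (koszul_diff u)"
  proof (rule koszul_eqI)
    fix B s
    show "kcoeff (koszul_diff (kscale a u)) B s = kcoeff (kscale a (koszul_diff u)) B s"
      unfolding kcoeff_simps kcoeff_koszul_diff[OF assms(1)]
        kcoeff_koszul_diff[OF koszul_module_closed(3)[OF assms(1)]] sum_distrib_left
      by (rule sum.cong) simp_all
  qed
qed

lemma koszul_diff_zero: "koszul_diff 0 = 0"
  by (simp add: koszul_diff_def)

lemma kcoeff_koszul_diff_nonzero:
  assumes u: "u \<in> carrier (koszul_module n c t)" and nz: "kcoeff (koszul_diff u) B s \<noteq> 0"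
  obtains m where "m \<in> monomials_of_deg n c" "m \<notin> B" "s = m + (s - m)" "kcoeff u (insert m B) (s - m) \<noteq> 0"
proof -
  obtain m where m: "m \<in> monomials_of_deg n c - B"
    "ins_sign m B * (if \<forall>x. Poly_Mapping.lookup m x \<le> Poly_Mapping.lookup s x then kcoeff u (insert m B) (s - m) else 0) \<noteq> 0"
    using nz unfolding kcoeff_koszul_diff[OF u] by (meson sum.neutral)
  then have le: "\<forall>x. Poly_Mapping.lookup m x \<le> Poly_Mapping.lookup s x" "kcoeff u (insert m B) (s - m) \<noteq> 0"
    by (auto split: if_splits)
  have "s = m + (s - m)" by (rule poly_mapping_eqI) (use le in \<open>simp add: lookup_add lookup_minus\<close>)
  then show thesis using that m le by blast
qed

lemma koszul_diff_carrier:
  assumes u: "u \<in> carrier (koszul_module n c t)"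
  shows "koszul_diff u \<in> carrier (koszul_module n c (t - 1))"
  unfolding koszul_module_carrier_iff
proof (intro allI impI)
  fix B s assume nz: "kcoeff (koszul_diff u) B s \<noteq> 0"
  obtain m where m: "m \<in> monomials_of_deg n c" "m \<notin> B" "s = m + (s - m)" "kcoeff u (insert m B) (s - m) \<noteq> 0"
    by (rule kcoeff_koszul_diff_nonzero[OF u nz])
  have B: "insert m B \<subseteq> monomials_of_deg n c" "int (card (insert m B)) = t" "s - m \<in> monomials n"
    using u[unfolded koszul_module_carrier_iff, rule_format, OF m(4)] by simp_all
  have "finite B" using finite_subset[OF B(1) finite_monomials_of_deg] by simp
  then have "int (card B) = t - 1" using B(2) m(2) by simp
  moreover have "Poly_Mapping.keys s \<subseteq> {..<n}"
    using keys_add[of m "s - m"] m(1,3) B(3) by (auto simp: monomials_of_deg_def monomials_def)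
  ultimately show "B \<subseteq> monomials_of_deg n c \<and> int (card B) = t - 1 \<and> s \<in> monomials n"
    using B(1) by (simp add: monomials_def)
qed

lemma mon_deg_add:
  assumes "m \<in> monomials n" "m' \<in> monomials n" shows "mon_deg (m + m') = mon_deg m + mon_deg m'"
proof -
  have "m + m' \<in> monomials n" using assms keys_add[of m m'] by (auto simp: monomials_def)
  then show ?thesis using assms by (simp add: mon_deg_eq lookup_add sum.distrib)
qed

lemma koszul_diff_homogeneous:
  assumes u: "u \<in> carrier (koszul_module n c t)" and h: "u \<in> koszul_homogeneous c j"
  shows "koszul_diff u \<in> koszul_homogeneous c j"
  unfolding koszul_homogeneous_iff
proof (intro allI impI)
  fix B s assume nz: "kcoeff (koszul_diff u) B s \<noteq> 0"
  obtain m where m: "m \<in> monomials_of_deg n c" "m \<notin> B" "s = m + (s - m)" "kcoeff u (insert m B) (s - m) \<noteq> 0"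
    by (rule kcoeff_koszul_diff_nonzero[OF u nz])
  have B: "insert m B \<subseteq> monomials_of_deg n c" "s - m \<in> monomials n"
    using u[unfolded koszul_module_carrier_iff, rule_format, OF m(4)] by simp_all
  have "finite B" using finite_subset[OF B(1) finite_monomials_of_deg] by simp
  then have "int (mon_deg (s - m)) + int ((card B + 1) * c) = j"
    using h[unfolded koszul_homogeneous_iff, rule_format, OF m(4)] m(2) by simp
  moreover have "mon_deg s = c + mon_deg (s - m)"
    using mon_deg_add[of m n "s - m"] m(1,3) B(2) by (simp add: monomials_of_deg_def)
  ultimately show "int (mon_deg s) + int (card B * c) = j" by (simp add: algebra_simps)
qed

definition koszul_cells :: "nat \<Rightarrow> nat \<Rightarrow> int \<Rightarrow> (monomial, nat \<Rightarrow> int) cell set" where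
  "koszul_cells n c j = orthant_cells (monomials_of_deg n c) n 0 j"

text \<open>The homogeneous part of degree \<open>j\<close> of \<open>u\<close>, as a function on cells. The truncation in \<open>mon_of\<close> has no
  effect, since \<open>b - total_exp A\<close> is nonnegative on the cells in question.\<close>

definition cell_coeff :: "nat \<Rightarrow> nat \<Rightarrow> int \<Rightarrow> 'k::field koszul \<Rightarrow> (monomial, nat \<Rightarrow> int) cell \<Rightarrow> 'k" where
  "cell_coeff n c j u = restr (koszul_cells n c j) (\<lambda>(A, b). kcoeff u A (mon_of n (\<lambda>x. b x - total_exp A x)))"

lemma koszul_cells_iff:
  "(A, b) \<in> koszul_cells n c j \<longleftrightarrow> A \<subseteq> monomials_of_deg n c \<and> (\<forall>x<n. total_exp A x \<le> b x) \<and> (\<forall>x\<ge>n. b x = 0) \<and> (\<Sum>x<n. b x) = j"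
  by (auto simp: koszul_cells_def orthant_cells_def)

lemma cell_coeff_linear:
  "cell_coeff n c j (u + v) = cell_coeff n c j u + cell_coeff n c j v"
  "cell_coeff n c j (u - v) = cell_coeff n c j u - cell_coeff n c j v"
  "cell_coeff n c j (kscale a u) = fscale a (cell_coeff n c j u)"
  "cell_coeff n c j 0 = 0"
  "cell_coeff n c j (\<Sum>i\<in>I. w i) = (\<Sum>i\<in>I. cell_coeff n c j (w i))"
  by (auto simp: cell_coeff_def restr_def fun_eq_iff sum_fun_apply)

lemma cell_coeff_level:
  assumes "u \<in> carrier (koszul_module n c t)"
  shows "cell_coeff n c j u \<in> supp_on (level t (koszul_cells n c j))"
  using assms unfolding koszul_module_carrier_iff
  by (auto simp: supp_on_def cell_coeff_def restr_def level_def)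

text \<open>In multidegree \<open>b\<close>, multiplication by \<open>m\<close> only shifts exponents: the monomial \<open>m\<close> divides the one
  attached to \<open>(B, b)\<close> exactly when \<open>(B \<union> {m}, b)\<close> is again a cell.\<close>

lemma cell_coeff_koszul_diff:
  assumes u: "u \<in> carrier (koszul_module n c t)"
  shows "cell_coeff n c j (koszul_diff u) = restr (koszul_cells n c j) (bd (monomials_of_deg n c) (cell_coeff n c j u))"
proof
  fix y :: "(monomial, nat \<Rightarrow> int) cell"
  obtain B b where y: "y = (B, b)" by (cases y)
  let ?U = "monomials_of_deg n c"
  show "cell_coeff n c j (koszul_diff u) y = restr (koszul_cells n c j) (bd ?U (cell_coeff n c j u)) y"
  proof (cases "y \<in> koszul_cells n c j")
    case True
    then have B: "B \<subseteq> ?U" "\<And>x. x < n \<Longrightarrow> total_exp B x \<le> b x" "\<And>x. x \<ge> n \<Longrightarrow> b x = 0" "(\<Sum>x<n. b x) = j"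
      by (auto simp: y koszul_cells_iff)
    have finB: "finite B" using finite_subset[OF B(1) finite_monomials_of_deg] .
    define s where "s = mon_of n (\<lambda>x. b x - total_exp B x)"
    have "cell_coeff n c j (koszul_diff u) y = kcoeff (koszul_diff u) B s"
      using True by (simp add: cell_coeff_def restr_def y s_def)
    also have "\<dots> = bd ?U (cell_coeff n c j u) (B, b)"
      unfolding kcoeff_koszul_diff[OF u] bd_def prod.case
    proof (rule sum.cong[OF refl])
      fix m assume m: "m \<in> ?U - B"
      have mz: "Poly_Mapping.lookup m x = 0" if "x \<ge> n" for x
        using m that monomials_lookup_zero by (auto simp: monomials_of_deg_def)
      have te: "total_exp (insert m B) x = int (Poly_Mapping.lookup m x) + total_exp B x" for x
        using total_exp_insert finB m by blast
      have ls: "Poly_Mapping.lookup s x = (if x < n then nat (b x - total_exp B x) else 0)" for x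
        by (simp add: s_def lookup_mon_of)
      have iff: "(insert m B, b) \<in> koszul_cells n c j \<longleftrightarrow> (\<forall>x. Poly_Mapping.lookup m x \<le> Poly_Mapping.lookup s x)"
      proof -
        have "(\<forall>x. Poly_Mapping.lookup m x \<le> Poly_Mapping.lookup s x) \<longleftrightarrow> (\<forall>x<n. total_exp (insert m B) x \<le> b x)"
          unfolding te ls using mz B(2) by (auto simp: nat_le_eq_zle le_nat_iff not_less)
        then show ?thesis using B m by (auto simp: koszul_cells_iff)
      qed
      have "mon_of n (\<lambda>x. b x - total_exp (insert m B) x) = s - m"
        by (rule poly_mapping_eqI) (auto simp: lookup_mon_of lookup_minus te ls mz nat_diff_distrib' algebra_simps)
      then show "ins_sign m B * (if \<forall>x. Poly_Mapping.lookup m x \<le> Poly_Mapping.lookup s x then kcoeff u (insert m B) (s - m) else 0)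
         = ins_sign m B * cell_coeff n c j u (insert m B, b)"
        using iff by (simp add: cell_coeff_def restr_def)
    qed
    finally show ?thesis using True by (simp add: restr_def y)
  qed (simp add: cell_coeff_def restr_def)
qed

lemma cell_coeff_injective:
  assumes u: "u \<in> carrier (koszul_module n c t)" "u \<in> koszul_homogeneous c j" and z: "cell_coeff n c j u = 0"
  shows "u = 0"
proof (rule koszul_eqI, rule ccontr)
  fix A m assume "kcoeff u A m \<noteq> kcoeff 0 A m"
  then have nz: "kcoeff u A m \<noteq> 0" by simp
  then have A: "A \<subseteq> monomials_of_deg n c" "m \<in> monomials n" "int (mon_deg m) + int (card A * c) = j"
    using u(1)[unfolded koszul_module_carrier_iff, rule_format, OF nz]
      u(2)[unfolded koszul_homogeneous_iff, rule_format, OF nz] by simp_all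
  define b where "b x = (if x < n then int (Poly_Mapping.lookup m x) + total_exp A x else 0)" for x
  have "(\<Sum>x<n. b x) = int (mon_deg m) + int (card A * c)"
    using sum_total_exp[OF A(1)] by (simp add: b_def sum.distrib mon_deg_eq[OF A(2)])
  then have cell: "(A, b) \<in> koszul_cells n c j" using A by (auto simp: koszul_cells_iff b_def)
  have "mon_of n (\<lambda>x. b x - total_exp A x) = m"
    by (rule poly_mapping_eqI) (use monomials_lookup_zero[OF A(2)] in \<open>auto simp: lookup_mon_of b_def\<close>)
  then have "cell_coeff n c j u (A, b) = kcoeff u A m" using cell by (simp add: cell_coeff_def restr_def)
  then show False using z nz by simp
qed

lemma finite_koszul_cells: "finite (koszul_cells n c j)"
  unfolding koszul_cells_def by (rule finite_orthant_cells[OF finite_monomials_of_deg])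

lemma cell_coeff_surjective:
  assumes f: "f \<in> supp_on (level t (koszul_cells n c j))"
  obtains u where "u \<in> carrier (koszul_module n c t)" "u \<in> koszul_homogeneous c j" "cell_coeff n c j u = f"
proof
  let ?F = "koszul_cells n c j"
  let ?s = "\<lambda>(A, b). mon_of n (\<lambda>x. b x - total_exp A x)"
  let ?e = "\<lambda>y. Poly_Mapping.single (fst y) (Poly_Mapping.single (?s y) (f y))"
  let ?u = "\<Sum>y\<in>?F. ?e y"
  have co: "kcoeff (?e y) A m = (if A = fst y \<and> m = ?s y then f y else 0)" for y A m
    by (auto simp: kcoeff_def lookup_single when_def)
  have nz: "\<exists>b. (A, b) \<in> level t ?F \<and> m = ?s (A, b)" if nzA: "kcoeff ?u A m \<noteq> 0" for A m
  proof -
    have "(\<Sum>y\<in>?F. kcoeff (?e y) A m) \<noteq> 0" using nzA by (simp only: kcoeff_simps not_False_eq_True)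
    then obtain y where y: "y \<in> ?F" "kcoeff (?e y) A m \<noteq> 0"
      by (rule sum.not_neutral_contains_not_neutral)
    then have Am: "A = fst y" "m = ?s y" and fy: "f y \<noteq> 0" unfolding co by (auto split: if_splits)
    have "y \<in> level t ?F" using f fy unfolding supp_on_def by blast
    moreover have "y = (A, snd y)" using Am(1) by simp
    ultimately show ?thesis using Am(2) by (intro exI[of _ "snd y"]) simp
  qed
  show "?u \<in> carrier (koszul_module n c t)" unfolding koszul_module_carrier_iff
  proof (intro allI impI)
    fix A m assume "kcoeff ?u A m \<noteq> 0"
    from nz[OF this] obtain b where "(A, b) \<in> level t ?F" "m = ?s (A, b)" by blast
    then show "A \<subseteq> monomials_of_deg n c \<and> int (card A) = t \<and> m \<in> monomials n"
      using mon_of_in_monomials by (auto simp: level_def koszul_cells_iff)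
  qed
  show "?u \<in> koszul_homogeneous c j" unfolding koszul_homogeneous_iff
  proof (intro allI impI)
    fix A m assume "kcoeff ?u A m \<noteq> 0"
    from nz[OF this] obtain b where b: "(A, b) \<in> ?F" "m = ?s (A, b)"
      unfolding level_def by blast
    have "int (mon_deg m) = (\<Sum>x<n. b x - total_exp A x)"
      using b by (auto simp: mon_deg_eq[OF mon_of_in_monomials] lookup_mon_of koszul_cells_iff intro!: sum.cong)
    then show "int (mon_deg m) + int (card A * c) = j"
      using b(1) sum_total_exp[of A n c] by (simp add: sum_subtractf koszul_cells_iff)
  qed
  have "cell_coeff n c j (?e y) = fscale (f y) (delta y)" if y: "y \<in> ?F" for y
  proof
    fix z :: "(monomial, nat \<Rightarrow> int) cell"
    show "cell_coeff n c j (?e y) z = fscale (f y) (delta y) z"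
    proof (cases "z \<in> ?F")
      case True
      have "z = y" if "fst z = fst y" "?s z = ?s y"
      proof -
        obtain A b where zA: "z = (A, b)" by (cases z)
        define b' where "b' = snd y"
        have yA: "y = (A, b')" using that(1) zA by (simp add: b'_def prod_eq_iff)
        have cb: "(A, b) \<in> ?F" "(A, b') \<in> ?F" using True y zA yA by auto
        have "b x = b' x" for x
        proof (cases "x < n")
          case True
          have "nat (b x - total_exp A x) = nat (b' x - total_exp A x)"
            using that(2) True lookup_mon_of[of n _ x] zA yA by (metis (no_types, lifting) prod.case)
          then show ?thesis using cb True by (auto simp: koszul_cells_iff nat_eq_iff)
        qed (use cb in \<open>auto simp: koszul_cells_iff\<close>)
        then show ?thesis using zA yA by auto
      qed
      then show ?thesis using True co by (auto simp: cell_coeff_def restr_def delta_def case_prod_unfold)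
    next
      case False
      then show ?thesis using y by (auto simp: cell_coeff_def restr_def delta_def)
    qed
  qed
  then have "cell_coeff n c j ?u = (\<Sum>y\<in>?F. fscale (f y) (delta y))"
    unfolding cell_coeff_linear by (intro sum.cong) auto
  also have "\<dots> = f"
    using supp_on_expand[OF finite_koszul_cells supp_on_mono[OF f level_subset]] by simp
  finally show "cell_coeff n c j ?u = f" .
qed

section \<open>The dimension of a homology component\<close>

text \<open>The vector space axioms pass to any structure whose elements are classes that are added and scaled
  through representatives.\<close>

lemma vectorspace_of_classes:
  fixes W :: "('k::field, 'w) module" and sc :: "'k \<Rightarrow> 'v::ab_group_add \<Rightarrow> 'v"
  assumes vs: "vector_space sc"
    and Y: "0 \<in> Y" "\<And>y z. y \<in> Y \<Longrightarrow> z \<in> Y \<Longrightarrow> y + z \<in> Y" "\<And>a y. y \<in> Y \<Longrightarrow> sc a y \<in> Y"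
    and car: "carrier W = cls ` Y" and zero: "\<zero>\<^bsub>W\<^esub> = cls 0"
    and add: "\<And>y z. y \<in> Y \<Longrightarrow> z \<in> Y \<Longrightarrow> cls y \<oplus>\<^bsub>W\<^esub> cls z = cls (y + z)"
    and smult: "\<And>a y. y \<in> Y \<Longrightarrow> a \<odot>\<^bsub>W\<^esub> cls y = cls (sc a y)"
  shows "vectorspace class_ring W"
proof -
  interpret vector_space sc by (rule vs)
  have neg: "- y \<in> Y" if "y \<in> Y" for y using Y(3)[OF that, of "-1"] by simp
  have "abelian_group W"
  proof (rule abelian_groupI)
    show "\<exists>y\<in>carrier W. y \<oplus>\<^bsub>W\<^esub> x = \<zero>\<^bsub>W\<^esub>" if x: "x \<in> carrier W" for x
    proof -
      obtain y where y: "y \<in> Y" "x = cls y" using x car by blast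
      then show ?thesis using neg[OF y(1)] add[OF neg[OF y(1)] y(1)] car zero
        by (intro bexI[of _ "cls (- y)"]) auto
    qed
  qed (auto simp: car zero add Y add_ac)
  moreover have "cring (class_ring :: 'k ring)" by (rule class_cring.is_cring)
  ultimately have "module (class_ring :: 'k ring) W"
    by (intro moduleI) (auto simp: car add smult Y scale_left_distrib scale_right_distrib)
  moreover have "field (class_ring :: 'k ring)" by (rule class_field.field_axioms)
  ultimately show ?thesis by (rule vectorspace.intro)
qed

text \<open>A family that is a basis modulo the kernel \<open>B\<close> of the class map gives an isomorphism from the space of
  vectors of length \<open>d\<close> to \<open>W\<close>.\<close>

lemma dim_of_classes:
  fixes W :: "('k::field, 'w) module" and sc :: "'k \<Rightarrow> 'v::ab_group_add \<Rightarrow> 'v"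
  assumes vs: "vector_space sc"
    and Y: "0 \<in> Y" "\<And>y z. y \<in> Y \<Longrightarrow> z \<in> Y \<Longrightarrow> y + z \<in> Y" "\<And>a y. y \<in> Y \<Longrightarrow> sc a y \<in> Y"
    and car: "carrier W = cls ` Y" and zero: "\<zero>\<^bsub>W\<^esub> = cls 0"
    and add: "\<And>y z. y \<in> Y \<Longrightarrow> z \<in> Y \<Longrightarrow> cls y \<oplus>\<^bsub>W\<^esub> cls z = cls (y + z)"
    and smult: "\<And>a y. y \<in> Y \<Longrightarrow> a \<odot>\<^bsub>W\<^esub> cls y = cls (sc a y)"
    and ker: "\<And>y z. y \<in> Y \<Longrightarrow> z \<in> Y \<Longrightarrow> cls y = cls z \<longleftrightarrow> y - z \<in> B"
    and e: "\<And>k. k < d \<Longrightarrow> e k \<in> Y"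
    and span: "\<And>y. y \<in> Y \<Longrightarrow> \<exists>a. y - (\<Sum>k<d. sc (a k) (e k)) \<in> B"
    and ind: "\<And>a. (\<Sum>k<d. sc (a k) (e k)) \<in> B \<Longrightarrow> \<forall>k<d. a k = 0"
  shows "vectorspace.dim (class_ring :: 'k ring) W = d"
proof -
  interpret sc: vector_space sc by (rule vs)
  interpret W: vectorspace "class_ring :: 'k ring" W
    by (rule vectorspace_of_classes[OF vs Y car zero add smult])
  interpret V: vec_space "TYPE('k)" d .
  let ?V = "module_vec TYPE('k) d"
  let ?T = "\<lambda>v. cls (\<Sum>k<d. sc (v $ k) (e k))"
  have sY: "(\<Sum>k\<in>I. f k) \<in> Y" if "\<And>k. k \<in> I \<Longrightarrow> f k \<in> Y" for f and I :: "nat set"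
    using that by (induction I rule: infinite_finite_induct) (auto simp: Y)
  have cY: "(\<Sum>k<d. sc (a k) (e k)) \<in> Y" for a by (intro sY Y(3) e) auto
  have "linear_map (class_ring :: 'k ring) ?V W ?T"
  proof (intro linear_map.intro mod_hom.intro mod_hom_axioms.intro)
    show "?T \<in> LinearCombinations.module_hom class_ring ?V W"
      unfolding LinearCombinations.module_hom_def
    proof (intro CollectI conjI ballI allI impI funcsetI)
      fix v show "?T v \<in> carrier W" using cY car by blast
    next
      fix v w assume "v \<in> carrier ?V \<and> w \<in> carrier ?V"
      then have "(\<Sum>k<d. sc ((v + w) $ k) (e k)) = (\<Sum>k<d. sc (v $ k) (e k) + sc (w $ k) (e k))"
        by (intro sum.cong) (auto simp: module_vec_simps sc.scale_left_distrib)
      then show "?T (v \<oplus>\<^bsub>?V\<^esub> w) = ?T v \<oplus>\<^bsub>W\<^esub> ?T w"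
        using add[OF cY cY, of "\<lambda>k. v $ k" "\<lambda>k. w $ k"] by (simp add: module_vec_simps sum.distrib)
    next
      fix a :: 'k and v assume "a \<in> carrier class_ring \<and> v \<in> carrier ?V"
      then have "(\<Sum>k<d. sc ((a \<cdot>\<^sub>v v) $ k) (e k)) = (\<Sum>k<d. sc a (sc (v $ k) (e k)))"
        by (intro sum.cong) (auto simp: module_vec_simps)
      then show "?T (a \<odot>\<^bsub>?V\<^esub> v) = a \<odot>\<^bsub>W\<^esub> ?T v"
        using smult[OF cY, of a "\<lambda>k. v $ k"] by (simp add: module_vec_simps sc.scale_sum_right)
    qed
  qed unfold_locales
  then interpret T: linear_map "class_ring :: 'k ring" ?V W ?T .
  have "inj_on ?T (carrier ?V)"
  proof (rule inj_onI)
    fix v w assume vw: "v \<in> carrier ?V" "w \<in> carrier ?V" "?T v = ?T w"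
    then have "(\<Sum>k<d. sc (v $ k) (e k)) - (\<Sum>k<d. sc (w $ k) (e k)) \<in> B" using ker[OF cY cY] by blast
    then have "(\<Sum>k<d. sc (v $ k - w $ k) (e k)) \<in> B"
      by (simp add: sc.scale_left_diff_distrib sum_subtractf)
    from ind[OF this] show "v = w" using vw by (intro eq_vecI) (auto simp: module_vec_simps)
  qed
  moreover have "?T ` carrier ?V = carrier W"
  proof
    show "?T ` carrier ?V \<subseteq> carrier W" using cY car by blast
    show "carrier W \<subseteq> ?T ` carrier ?V"
    proof
      fix x assume "x \<in> carrier W"
      then obtain y where y: "y \<in> Y" "x = cls y" using car by blast
      obtain a where a: "y - (\<Sum>k<d. sc (a k) (e k)) \<in> B" using span[OF y(1)] by blast
      have "x = cls (\<Sum>k<d. sc (a k) (e k))" using ker[OF y(1) cY] a y(2) by blast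
      also have "\<dots> = ?T (vec d a)" by simp
      finally show "x \<in> ?T ` carrier ?V" by (rule image_eqI) (simp add: module_vec_simps)
    qed
  qed
  ultimately have "V.dim = W.dim" using T.dim_eq V.fin_dim by blast
  then show ?thesis using V.dim_is_n by simp
qed

text \<open>The restriction of \<open>cell_coeff\<close> to homogeneous elements of degree \<open>j\<close> is an isomorphism of complexes. On
  arbitrary elements it is still compatible with the differentials, and this is what shows that a homogeneous
  boundary is the boundary of a homogeneous element.\<close>

lemma koszul_homology_component_dim:
  fixes n c d :: nat and i j :: int
  assumes d: "homology_dim (bd (monomials_of_deg n c) :: _ \<Rightarrow> _ \<Rightarrow> 'k::field) (koszul_cells n c j) i d"
  shows "vectorspace.dim (class_ring :: 'k ring)
    (koszul_homology_component n c i j :: ('k, 'k koszul set) module) = d"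
proof -
  let ?C = "\<lambda>t. carrier (koszul_module n c t) :: 'k koszul set" and ?H = "koszul_homogeneous c j :: 'k koszul set"
  let ?D = "bd (monomials_of_deg n c) :: ((monomial, nat \<Rightarrow> int) cell \<Rightarrow> 'k) \<Rightarrow> _"
  let ?F = "koszul_cells n c j"
  let ?t = "cell_coeff n c j :: 'k koszul \<Rightarrow> _"
  define Z where "Z = {u \<in> ?C i. koszul_diff u = 0}"
  define B where "B = (koszul_boundaries n c i :: 'k koszul set)"
  define Y where "Y = Z \<inter> ?H"
  define cls where "cls z = {b + z | b. b \<in> B}" for z
  have neg: "- u = kscale (-1) u" for u :: "'k koszul" by (simp add: kvec.scale_minus_left)
  have diffclosed: "u - v \<in> S" if "u \<in> S" "v \<in> S" "\<And>u v. u \<in> S \<Longrightarrow> v \<in> S \<Longrightarrow> u + v \<in> S" "\<And>a u. u \<in> S \<Longrightarrow> kscale a u \<in> S"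
    for u v :: "'k koszul" and S
    using that(3)[OF that(1) that(4)[OF that(2), of "-1"]] by (simp add: kvec.scale_minus_left)
  note closed = koszul_module_closed koszul_homogeneous_closed
  have B: "0 \<in> B" "\<And>u v. u \<in> B \<Longrightarrow> v \<in> B \<Longrightarrow> u + v \<in> B" "\<And>a u. u \<in> B \<Longrightarrow> kscale a u \<in> B"
  proof -
    show "0 \<in> B" unfolding B_def koszul_boundaries_def
      by (rule image_eqI[of _ _ 0]) (simp_all add: koszul_diff_zero closed)
    show "u + v \<in> B" if uv: "u \<in> B" "v \<in> B" for u v
    proof -
      obtain u' v' where "u' \<in> ?C (i + 1)" "v' \<in> ?C (i + 1)" "u = koszul_diff u'" "v = koszul_diff v'"
        using uv unfolding B_def koszul_boundaries_def by blast
      then show ?thesis unfolding B_def koszul_boundaries_def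
        by (intro image_eqI[of _ _ "u' + v'"]) (simp_all add: koszul_diff_linear closed)
    qed
    show "kscale a u \<in> B" if u: "u \<in> B" for a u
    proof -
      obtain u' where "u' \<in> ?C (i + 1)" "u = koszul_diff u'"
        using u unfolding B_def koszul_boundaries_def by blast
      then show ?thesis unfolding B_def koszul_boundaries_def
        by (intro image_eqI[of _ _ "kscale a u'"]) (simp_all add: koszul_diff_linear closed)
    qed
  qed
  have Y: "0 \<in> Y" "\<And>y z. y \<in> Y \<Longrightarrow> z \<in> Y \<Longrightarrow> y + z \<in> Y" "\<And>a y. y \<in> Y \<Longrightarrow> kscale a y \<in> Y"
    by (auto simp: Y_def Z_def closed koszul_diff_linear koszul_diff_zero)
  have cls_eq: "cls y = cls z \<longleftrightarrow> y - z \<in> B" for y z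
  proof
    assume "cls y = cls z"
    moreover have "y \<in> cls y" unfolding cls_def using B(1) by force
    ultimately obtain b where "b \<in> B" "y = b + z" unfolding cls_def by blast
    then show "y - z \<in> B" by simp
  next
    have sub: "cls y \<subseteq> cls z" if "y - z \<in> B" for y z
    proof
      fix x assume "x \<in> cls y"
      then obtain b where "b \<in> B" "x = b + y" by (auto simp: cls_def)
      then have "b + (y - z) \<in> B" "x = (b + (y - z)) + z" using B(2) that by auto
      then show "x \<in> cls z" unfolding cls_def by blast
    qed
    assume yz: "y - z \<in> B"
    then have "z - y \<in> B" using B(3)[OF yz, of "-1"] by (simp add: kvec.scale_minus_left)
    then show "cls y = cls z" using sub yz by blast
  qed
  have coset: "koszul_boundaries n c i +>\<^bsub>koszul_cycles n c i\<^esub> z = cls z" for z :: "'k koszul"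
    by (auto simp: a_r_coset_def' cls_def B_def koszul_cycles_def koszul_module_def)
  let ?W = "koszul_homology_component n c i j :: ('k, 'k koszul set) module"
  have car: "carrier ?W = cls ` Y"
  proof -
    have "carrier (koszul_cycles n c i) = Z" by (simp add: Z_def koszul_cycles_def)
    then show ?thesis by (simp add: koszul_homology_component_def coset Y_def)
  qed
  have zero: "\<zero>\<^bsub>?W\<^esub> = cls 0"
    by (auto simp: koszul_homology_component_def koszul_homology_def fact_module_def cls_def B_def)
  have add: "cls y \<oplus>\<^bsub>?W\<^esub> cls z = cls (y + z)" for y z
  proof -
    have "cls y \<oplus>\<^bsub>?W\<^esub> cls z = {u + v | u v. u \<in> cls y \<and> v \<in> cls z}"
      by (auto simp: koszul_homology_component_def koszul_homology_def fact_module_def set_add_def'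
          koszul_cycles_def koszul_module_def)
    also have "\<dots> = cls (y + z)"
    proof (intro equalityI subsetI)
      fix x assume "x \<in> {u + v | u v. u \<in> cls y \<and> v \<in> cls z}"
      then obtain a b where "a \<in> B" "b \<in> B" "x = (a + y) + (b + z)" by (auto simp: cls_def)
      then have "a + b \<in> B" "x = (a + b) + (y + z)" using B(2) by (auto simp: add_ac)
      then show "x \<in> cls (y + z)" unfolding cls_def by blast
    next
      fix x assume "x \<in> cls (y + z)"
      then obtain b where b: "b \<in> B" "x = b + (y + z)" by (auto simp: cls_def)
      have "b + y \<in> cls y" "0 + z \<in> cls z" using b(1) B(1) unfolding cls_def by blast+
      moreover have "x = (b + y) + (0 + z)" using b(2) by (simp add: add_ac)
      ultimately show "x \<in> {u + v | u v. u \<in> cls y \<and> v \<in> cls z}" by blast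
    qed
    finally show ?thesis .
  qed
  have smult: "a \<odot>\<^bsub>?W\<^esub> cls y = cls (kscale a y)" for a y
  proof -
    have "a \<odot>\<^bsub>?W\<^esub> cls y = (\<Union>x\<in>cls y. cls (kscale a x))"
      by (simp add: koszul_homology_component_def koszul_homology_def fact_module_def coset)
        (simp add: koszul_cycles_def koszul_module_def kscale_def)
    also have "\<dots> = cls (kscale a y)"
    proof -
      have "cls (kscale a x) = cls (kscale a y)" if x: "x \<in> cls y" for x
      proof -
        obtain b where b: "b \<in> B" "x = b + y" using x by (auto simp: cls_def)
        then show ?thesis unfolding cls_eq using B(3)[OF b(1)] by (simp add: kvec.scale_right_distrib)
      qed
      moreover have "cls y \<noteq> {}" using B(1) by (auto simp: cls_def)
      ultimately show ?thesis by auto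
    qed
    finally show ?thesis .
  qed
  have boundary_iff: "y \<in> B \<longleftrightarrow> ?t y \<in> boundaries_on ?D ?F i" if y: "y \<in> Y" for y
  proof
    assume "y \<in> B"
    then obtain u where u: "u \<in> ?C (i + 1)" "y = koszul_diff u" unfolding B_def koszul_boundaries_def by blast
    show "?t y \<in> boundaries_on ?D ?F i" unfolding boundaries_on_def
      by (rule image_eqI[of _ _ "?t u"]) (simp_all add: u(2) cell_coeff_koszul_diff[OF u(1)] cell_coeff_level[OF u(1)])
  next
    assume "?t y \<in> boundaries_on ?D ?F i"
    then obtain f where f: "f \<in> supp_on (level (i + 1) ?F)" "?t y = restr ?F (?D f)"
      unfolding boundaries_on_def by blast
    obtain u where u: "u \<in> ?C (i + 1)" "u \<in> ?H" "?t u = f" by (rule cell_coeff_surjective[OF f(1)])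
    have Du: "koszul_diff u \<in> ?C i" "koszul_diff u \<in> ?H"
      using koszul_diff_carrier[OF u(1)] koszul_diff_homogeneous[OF u(1,2)] by simp_all
    have yC: "y \<in> ?C i" "y \<in> ?H" using y by (auto simp: Y_def Z_def)
    have "?t (y - koszul_diff u) = 0"
      by (simp add: cell_coeff_linear(2) cell_coeff_koszul_diff[OF u(1)] u(3) f(2))
    then have "y - koszul_diff u = 0"
      by (rule cell_coeff_injective[rotated 2])
        (rule diffclosed[OF yC(1) Du(1) closed(2,3)] diffclosed[OF yC(2) Du(2) closed(5,6)]; assumption)+
    then show "y \<in> B" using u(1) unfolding B_def koszul_boundaries_def by auto
  qed
  obtain e where e: "\<And>k. k < d \<Longrightarrow> e k \<in> cycles_on ?D ?F i"
    and sp: "\<And>z. z \<in> cycles_on ?D ?F i \<Longrightarrow> \<exists>a. z - (\<Sum>k<d. fscale (a k) (e k)) \<in> boundaries_on ?D ?F i"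
    and ind: "\<And>a. (\<Sum>k<d. fscale (a k) (e k)) \<in> boundaries_on ?D ?F i \<Longrightarrow> (\<forall>k<d. a k = 0)"
    using d unfolding homology_dim_def quot_dim_def by blast
  have "\<exists>u\<in>Y. ?t u = e k" if k: "k < d" for k
  proof -
    have ek: "e k \<in> supp_on (level i ?F)" "restr ?F (?D (e k)) = 0" using e[OF k] by (auto simp: cycles_on_def)
    obtain u where u: "u \<in> ?C i" "u \<in> ?H" "?t u = e k" by (rule cell_coeff_surjective[OF ek(1)])
    have "?t (koszul_diff u) = 0" using cell_coeff_koszul_diff[OF u(1)] u(3) ek(2) by simp
    then have "koszul_diff u = 0"
      by (rule cell_coeff_injective[OF koszul_diff_carrier[OF u(1)] koszul_diff_homogeneous[OF u(1,2)]])
    then show ?thesis using u by (auto simp: Y_def Z_def)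
  qed
  then obtain e' where e': "\<And>k. k < d \<Longrightarrow> e' k \<in> Y" "\<And>k. k < d \<Longrightarrow> ?t (e' k) = e k" by metis
  have te: "?t (\<Sum>k<d. kscale (a k) (e' k)) = (\<Sum>k<d. fscale (a k) (e k))" for a
    unfolding cell_coeff_linear by (rule sum.cong) (simp_all add: e')
  have sY: "(\<Sum>k<d. kscale (a k) (e' k)) \<in> Y" for a
  proof -
    have "m \<le> d \<Longrightarrow> (\<Sum>k<m. kscale (a k) (e' k)) \<in> Y" for m
      by (induction m) (auto simp: Y e')
    then show ?thesis by blast
  qed
  show ?thesis
  proof (rule dim_of_classes[OF kvec.vector_space_axioms Y car zero add smult])
    show "cls y = cls z \<longleftrightarrow> y - z \<in> B" for y z by (rule cls_eq)
    show "e' k \<in> Y" if "k < d" for k using e' that by blast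
    show "\<exists>a. y - (\<Sum>k<d. kscale (a k) (e' k)) \<in> B" if y: "y \<in> Y" for y
    proof -
      have "y \<in> ?C i" "koszul_diff y = 0" using y by (auto simp: Y_def Z_def)
      then have "?t y \<in> cycles_on ?D ?F i"
        using cell_coeff_level cell_coeff_koszul_diff[of y n c i j] by (auto simp: cycles_on_def cell_coeff_linear(4))
      then obtain a where a: "?t y - (\<Sum>k<d. fscale (a k) (e k)) \<in> boundaries_on ?D ?F i" using sp by blast
      have "?t (y - (\<Sum>k<d. kscale (a k) (e' k))) \<in> boundaries_on ?D ?F i"
        using a te by (simp add: cell_coeff_linear(2))
      moreover have "y - (\<Sum>k<d. kscale (a k) (e' k)) \<in> Y" by (rule diffclosed[OF y sY Y(2,3)])
      ultimately have "y - (\<Sum>k<d. kscale (a k) (e' k)) \<in> B" by (simp only: boundary_iff)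
      then show ?thesis by (rule exI[of _ a])
    qed
    show "\<forall>k<d. a k = 0" if a: "(\<Sum>k<d. kscale (a k) (e' k)) \<in> B" for a
      by (rule ind) (use a boundary_iff[OF sY[of a]] te[of a] in simp)
  qed
qed

theorem proposition4p4:
  fixes n c N :: nat and i j :: int
  assumes "c \<ge> 1"
    and "N = (n + c - 1) choose c"
    and "i \<ge> 0" and "j \<ge> 0"
  shows "vectorspace.dim (class_ring :: 'k::field ring)
           (koszul_homology_component n c i j :: ('k, 'k koszul set) module)
       = vectorspace.dim (class_ring :: 'k ring)
           (koszul_homology_component n c (int N - int n - i) (int (N * c) - int n - j)
              :: ('k, 'k koszul set) module)"
proof -
  let ?U = "monomials_of_deg n c"
  have U: "finite ?U" by (rule finite_monomials_of_deg)
  have N: "card ?U = N" using assms(2) card_monomials_of_deg by simp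
  have T: "(\<Sum>x<n. total_exp ?U x) = int (N * c)" using sum_total_exp[OF subset_refl, of n c] by (simp add: N)
  have sub: "orthant_cells ?U n 0 j \<subseteq> Pow ?U \<times> UNIV" by (auto simp: orthant_cells_def)
  obtain d where d: "homology_dim (bd ?U :: _ \<Rightarrow> _ \<Rightarrow> 'k) (orthant_cells ?U n 0 j) i d"
    using homology_dim_exists[OF U finite_orthant_cells[OF U] sub convex_orthant_cells[OF U]] by blast
  have "homology_dim (bd ?U :: _ \<Rightarrow> _ \<Rightarrow> 'k)
      (orthant_cells ?U n 0 (int (N * c) - int n - j)) (int N - int n - i) d"
    using homology_dim_orthant_duality[OF U pure_power_in_monomials_of_deg d]
    unfolding T N .
  then show ?thesis
    using d koszul_homology_component_dim[of n c j i d, where ?'k = 'k]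
      koszul_homology_component_dim[of n c "int (N * c) - int n - j" "int N - int n - i" d, where ?'k = 'k]
    by (simp add: koszul_cells_def)
qed

end
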